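(* Let $n\ge 2$. For every $\phi\in L^\infty(\mathbb T^n)$, $$T_{\phi,\triangle_n}=\Psi^{-1}\,T_{\phi\circ\varphi^{-1},\mathbb D^n}\,\Psi\qquad\text{and}\qquad T_{\phi,\mathbb D^n}=\Psi\,T_{\phi\circ\varphi,\triangle_n}\,\Psi^{-1},$$ where $\Psi:H^2(\partial_d(\triangle_n))\to H^2(\partial_d(\mathbb D^n))$ is the unitary map $\Psi(f)=J_{\varphi^{-1}}\cdot (f\circ\varphi^{-1})$.
   Context: Let $n\ge2$, $\mathbb D$ the open unit disc, $\mathbb T$ the unit circle, and let $\triangle_n=\{z\in\mathbb C^n:|z_1|<|z_2|<\dots<|z_n|<1\}$ be the $n$-dimensional Hartogs triangle. $L^2(\mathbb T^n)$ and $L^\infty(\mathbb T^n)$ are taken with respect to normalized Lebesgue measure on $\mathbb T^n$; $\mathbb T^n$ is the distinguished boundary of both $\mathbb D^n$ and $\triangle_n$. Let $\varphi(z)=\left(\frac{z_1}{z_2},\dots,\frac{z_{n-1}}{z_n},z_n\right)$, with inverse $\varphi^{-1}(z)=\left(\prod_{j=1}^n z_j,\prod_{j=2}^n z_j,\dots,z_{n-1}z_n,z_n\right)$. The map $\varphi$ is a biholomorphism from $\triangle_n$ onto $\mathbb D\times(\mathbb D\setminus\{0\})^{n-1}$, and the same formulas define mutually inverse homeomorphisms of $\mathbb T^n$. Their Jacobians are $J_\varphi(z)=\frac1{z_2\cdots z_n}$ and $J_{\varphi^{-1}}(z)=\prod_{j=2}^n z_j^{j-1}$. Hardy spaces as closed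 subspaces of $L^2(\mathbb T^n)$: $H^2(\partial_d(\mathbb D^n))$ is the set of $f\in L^2(\mathbb T^n)$ of the form $\sum_{\alpha\in\mathbb Z_+^n}a_\alpha\zeta^\alpha$ with $(a_\alpha)\in\ell^2$, where $\mathbb Z_+$ is the set of nonnegative integers; $H^2(\partial_d(\triangle_n))$ is the set of $f\in L^2(\mathbb T^n)$ of the form $\sum_{\alpha\in\mathcal I}a_\alpha\zeta^\alpha$ with $(a_\alpha)\in\ell^2$, where $\mathcal I=\{\alpha\in\mathbb Z^n:\sum_{j=1}^k\alpha_j+k-1\ge0,\ k=1,\dots,n\}$. These are identified with the Hardy spaces $H^2(\mathbb D^n)$ and $H^2(\triangle_n)$ through boundary values. For $\Omega=\mathbb D^n$ or $\triangle_n$ and $\phi\in L^\infty(\mathbb T^n)$, the Toeplitz operator on $H^2(\partial_d(\Omega))$ is $T_{\phi,\Omega}(f)=P_{H^2(\partial_d(\Omega))}(\phi f)$, where $P_{H^2(\partial_d(\Omega))}$ is the orthogonal projection of $L^2(\mathbb T^n)$ onto $H^2(\partial_d(\Omega))$. *)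

theory Defs
  imports "HOL-Analysis.Analysis" "Jordan_Normal_Form.Determinant"
begin

section \<open>The Hilbert space of square-integrable functions modulo equality almost everywhere\<close>

definition L2_fun :: "'a measure \<Rightarrow> ('a \<Rightarrow> complex) set" where
  "L2_fun M = {f \<in> borel_measurable M. integrable M (\<lambda>x. (norm (f x))\<^sup>2)}"

definition L2_rel :: "'a measure \<Rightarrow> (('a \<Rightarrow> complex) \<times> ('a \<Rightarrow> complex)) set" where
  "L2_rel M = {(f, g). f \<in> L2_fun M \<and> g \<in> L2_fun M \<and> (AE x in M. f x = g x)}"

definition L2 :: "'a measure \<Rightarrow> ('a \<Rightarrow> complex) set set" where
  "L2 M = L2_fun M // L2_rel M"

definition L2_class :: "'a measure \<Rightarrow> ('a \<Rightarrow> complex) \<Rightarrow> ('a \<Rightarrow> complex) set" where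
  "L2_class M f = L2_rel M `` {f}"

text \<open>Operations on classes are computed on an arbitrarily chosen representative; all of them
  respect equality almost everywhere.\<close>

definition L2_rep :: "('a \<Rightarrow> complex) set \<Rightarrow> 'a \<Rightarrow> complex" where
  "L2_rep F = (SOME f. f \<in> F)"

definition L2_add :: "'a measure \<Rightarrow> ('a \<Rightarrow> complex) set \<Rightarrow> ('a \<Rightarrow> complex) set \<Rightarrow> ('a \<Rightarrow> complex) set"
  where "L2_add M F G = L2_class M (\<lambda>x. L2_rep F x + L2_rep G x)"

definition L2_diff :: "'a measure \<Rightarrow> ('a \<Rightarrow> complex) set \<Rightarrow> ('a \<Rightarrow> complex) set \<Rightarrow> ('a \<Rightarrow> complex) set"
  where "L2_diff M F G = L2_class M (\<lambda>x. L2_rep F x - L2_rep G x)"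

definition L2_scale :: "'a measure \<Rightarrow> complex \<Rightarrow> ('a \<Rightarrow> complex) set \<Rightarrow> ('a \<Rightarrow> complex) set"
  where "L2_scale M c F = L2_class M (\<lambda>x. c * L2_rep F x)"

definition L2_inner :: "'a measure \<Rightarrow> ('a \<Rightarrow> complex) set \<Rightarrow> ('a \<Rightarrow> complex) set \<Rightarrow> complex" where
  "L2_inner M F G = (LINT x|M. L2_rep F x * cnj (L2_rep G x))"

definition L2_norm :: "'a measure \<Rightarrow> ('a \<Rightarrow> complex) set \<Rightarrow> real" where
  "L2_norm M F = sqrt (Re (L2_inner M F F))"

definition orth_proj ::
  "'a measure \<Rightarrow> ('a \<Rightarrow> complex) set set \<Rightarrow> ('a \<Rightarrow> complex) set \<Rightarrow> ('a \<Rightarrow> complex) set" where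
  "orth_proj M H F = (THE G. G \<in> H \<and> (\<forall>K\<in>H. L2_inner M (L2_diff M F G) K = 0))"

definition unitary_between ::
  "'a measure \<Rightarrow> ('a \<Rightarrow> complex) set set \<Rightarrow> ('a \<Rightarrow> complex) set set
    \<Rightarrow> (('a \<Rightarrow> complex) set \<Rightarrow> ('a \<Rightarrow> complex) set) \<Rightarrow> bool" where
  "unitary_between M H K U \<longleftrightarrow>
     bij_betw U H K \<and>
     (\<forall>F\<in>H. \<forall>G\<in>H. U (L2_add M F G) = L2_add M (U F) (U G)) \<and>
     (\<forall>c. \<forall>F\<in>H. U (L2_scale M c F) = L2_scale M c (U F)) \<and>
     (\<forall>F\<in>H. \<forall>G\<in>H. L2_inner M (U F) (U G) = L2_inner M F G)"

text \<open>Symbols are bounded representatives, not classes; the Toeplitz operator below depends on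
  the symbol only up to equality almost everywhere.\<close>

definition Linfty_fun :: "'a measure \<Rightarrow> ('a \<Rightarrow> complex) set" where
  "Linfty_fun M = {f \<in> borel_measurable M. \<exists>C. AE x in M. norm (f x) \<le> C}"

definition toeplitz ::
  "'a measure \<Rightarrow> ('a \<Rightarrow> complex) set set \<Rightarrow> ('a \<Rightarrow> complex) \<Rightarrow> ('a \<Rightarrow> complex) set \<Rightarrow> ('a \<Rightarrow> complex) set"
  where "toeplitz M H \<phi> F = orth_proj M H (L2_class M (\<lambda>x. \<phi> x * L2_rep F x))"


section \<open>The torus and the Hardy spaces\<close>

text \<open>Points of the torus are functions on \<open>{1..n}\<close> with unimodular values, extended by
  \<open>undefined\<close> outside \<open>{1..n}\<close>; multi-indices are treated in the same way.\<close>

definition circle_measure :: "complex measure" where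
  "circle_measure = distr (uniform_measure lborel {0..<2 * pi}) (restrict_space borel (sphere 0 1)) cis"

definition torus :: "nat \<Rightarrow> (nat \<Rightarrow> complex) measure" where
  "torus n = PiM {1..n} (\<lambda>_. circle_measure)"

definition laurent_monom :: "nat \<Rightarrow> (nat \<Rightarrow> int) \<Rightarrow> (nat \<Rightarrow> complex) \<Rightarrow> complex" where
  "laurent_monom n \<alpha> z = (\<Prod>j=1..n. z j powi \<alpha> j)"

definition hardy :: "nat \<Rightarrow> (nat \<Rightarrow> int) set \<Rightarrow> ((nat \<Rightarrow> complex) \<Rightarrow> complex) set set" where
  "hardy n A = {F \<in> L2 (torus n). \<exists>a. (\<lambda>\<alpha>. (norm (a \<alpha> :: complex))\<^sup>2) summable_on A \<and>
     ((\<lambda>S. L2_norm (torus n)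
         (L2_diff (torus n) F (L2_class (torus n) (\<lambda>z. \<Sum>\<alpha>\<in>S. a \<alpha> * laurent_monom n \<alpha> z))))
       \<longlongrightarrow> 0) (finite_subsets_at_top A)}"

definition polydisc_indices :: "nat \<Rightarrow> (nat \<Rightarrow> int) set" where
  "polydisc_indices n = {1..n} \<rightarrow>\<^sub>E {0..}"

definition hartogs_indices :: "nat \<Rightarrow> (nat \<Rightarrow> int) set" where
  "hartogs_indices n =
     {\<alpha> \<in> {1..n} \<rightarrow>\<^sub>E UNIV. \<forall>k\<in>{1..n}. (\<Sum>j=1..k. \<alpha> j) + int k - 1 \<ge> 0}"

definition H2_polydisc :: "nat \<Rightarrow> ((nat \<Rightarrow> complex) \<Rightarrow> complex) set set" where
  "H2_polydisc n = hardy n (polydisc_indices n)"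

definition H2_hartogs :: "nat \<Rightarrow> ((nat \<Rightarrow> complex) \<Rightarrow> complex) set set" where
  "H2_hartogs n = hardy n (hartogs_indices n)"

definition toeplitz_polydisc ::
  "nat \<Rightarrow> ((nat \<Rightarrow> complex) \<Rightarrow> complex) \<Rightarrow> ((nat \<Rightarrow> complex) \<Rightarrow> complex) set
    \<Rightarrow> ((nat \<Rightarrow> complex) \<Rightarrow> complex) set" where
  "toeplitz_polydisc n = toeplitz (torus n) (H2_polydisc n)"

definition toeplitz_hartogs ::
  "nat \<Rightarrow> ((nat \<Rightarrow> complex) \<Rightarrow> complex) \<Rightarrow> ((nat \<Rightarrow> complex) \<Rightarrow> complex) set
    \<Rightarrow> ((nat \<Rightarrow> complex) \<Rightarrow> complex) set" where
  "toeplitz_hartogs n = toeplitz (torus n) (H2_hartogs n)"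


section \<open>The biholomorphism and the map \<open>\<Psi>\<close>\<close>

definition hartogs_map :: "nat \<Rightarrow> (nat \<Rightarrow> complex) \<Rightarrow> nat \<Rightarrow> complex" where
  "hartogs_map n z = (\<lambda>j\<in>{1..n}. if j = n then z n else z j / z (j + 1))"

definition hartogs_map_inv :: "nat \<Rightarrow> (nat \<Rightarrow> complex) \<Rightarrow> nat \<Rightarrow> complex" where
  "hartogs_map_inv n z = (\<lambda>j\<in>{1..n}. \<Prod>i=j..n. z i)"

text \<open>The complex Jacobian determinant; matrix indices start at \<open>0\<close>, coordinates at \<open>1\<close>.\<close>

definition jacobian ::
  "nat \<Rightarrow> ((nat \<Rightarrow> complex) \<Rightarrow> nat \<Rightarrow> complex) \<Rightarrow> (nat \<Rightarrow> complex) \<Rightarrow> complex" where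
  "jacobian n f z =
     Determinant.det (mat n n (\<lambda>(j, k). deriv (\<lambda>w. f (z(k + 1 := w)) (j + 1)) (z (k + 1))))"

lemma jacobian_hartogs_map_inv:
  "jacobian n (hartogs_map_inv n) z = (\<Prod>j=2..n. z j ^ (j - 1))"
proof -
  let ?A = "mat n n (\<lambda>(j, k). deriv (\<lambda>w. hartogs_map_inv n (z(k + 1 := w)) (j + 1)) (z (k + 1)))"
  have entry: "deriv (\<lambda>w. hartogs_map_inv n (z(k + 1 := w)) (j + 1)) (z (k + 1)) =
      (if k < j then 0 else \<Prod>i\<in>{j+1..n} - {k+1}. z i)" if "j < n" "k < n" for j k
  proof (cases "k < j")
    case True
    have "(\<lambda>w. hartogs_map_inv n (z(k + 1 := w)) (j + 1)) = (\<lambda>w. \<Prod>i=j+1..n. z i)"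
      using that True by (auto simp: hartogs_map_inv_def intro!: prod.cong)
    then show ?thesis using True by simp
  next
    case False
    have "(\<lambda>w. hartogs_map_inv n (z(k + 1 := w)) (j + 1)) =
        (\<lambda>w. w * (\<Prod>i\<in>{j+1..n} - {k+1}. z i))"
    proof
      fix w
      have "hartogs_map_inv n (z(k + 1 := w)) (j + 1) = (\<Prod>i=j+1..n. (z(k + 1 := w)) i)"
        using that by (simp add: hartogs_map_inv_def)
      also have "\<dots> = (z(k + 1 := w)) (k + 1) * (\<Prod>i\<in>{j+1..n} - {k+1}. (z(k + 1 := w)) i)"
        using that False by (intro prod.remove) auto
      also have "(\<Prod>i\<in>{j+1..n} - {k+1}. (z(k + 1 := w)) i) = (\<Prod>i\<in>{j+1..n} - {k+1}. z i)"
        by (intro prod.cong) auto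
      finally show "hartogs_map_inv n (z(k + 1 := w)) (j + 1) =
          w * (\<Prod>i\<in>{j+1..n} - {k+1}. z i)" by (simp only: fun_upd_same)
    qed
    then show ?thesis using False by simp
  qed
  have "Determinant.det ?A = prod_list (diag_mat ?A)"
    by (rule det_upper_triangular[of _ n]) (auto simp: entry simp del: One_nat_def)
  also have "\<dots> = (\<Prod>j<n. ?A $$ (j, j))"
    by (simp add: prod_list_diag_prod atLeast0LessThan)
  also have "\<dots> = (\<Prod>j<n. \<Prod>i\<in>{j+2..n}. z i)"
  proof (rule prod.cong)
    fix j assume "j \<in> {..<n}"
    then show "?A $$ (j, j) = (\<Prod>i\<in>{j+2..n}. z i)"
      using entry[of j j] by (auto intro!: prod.cong)
  qed simp
  also have "\<dots> = (\<Prod>i=2..n. \<Prod>j<i-1. z i)"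
    unfolding prod.Sigma[OF finite_lessThan ballI[OF finite_atLeastAtMost]]
      prod.Sigma[OF finite_atLeastAtMost ballI[OF finite_lessThan]]
    by (rule prod.reindex_bij_witness[of _ "\<lambda>(i, j). (j, i)" "\<lambda>(j, i). (i, j)"]) auto
  also have "\<dots> = (\<Prod>j=2..n. z j ^ (j - 1))" by simp
  finally show ?thesis by (simp add: jacobian_def)
qed

definition Psi :: "nat \<Rightarrow> ((nat \<Rightarrow> complex) \<Rightarrow> complex) set \<Rightarrow> ((nat \<Rightarrow> complex) \<Rightarrow> complex) set" where
  "Psi n F = L2_class (torus n)
     (\<lambda>z. jacobian n (hartogs_map_inv n) z * L2_rep F (hartogs_map_inv n z))"

abbreviation Psi_inv :: "nat \<Rightarrow> ((nat \<Rightarrow> complex) \<Rightarrow> complex) set \<Rightarrow> ((nat \<Rightarrow> complex) \<Rightarrow> complex) set" where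
  "Psi_inv n \<equiv> inv_into (H2_hartogs n) (Psi n)"

end

theory Submission
  imports Defs
begin

text \<open>The map \<open>h = hartogs_map n\<close> is an automorphism of the torus regarded as a compact group: in the
exponents it is an integer matrix of determinant \<open>1\<close>. Its inverse therefore preserves
normalized Lebesgue measure, and the Jacobian \<open>\<Prod> z\<^sub>j\<^bsup>j-1\<^esup>\<close> is unimodular on the torus, so
\<open>f \<mapsto> J \<cdot> (f \<circ> h\<^bsup>-1\<^esup>)\<close> is unitary on the whole of \<open>L\<^sup>2\<close> (\<open>bij_class_wcomp\<close>,
\<open>class_wcomp_inner\<close>). It carries monomials to monomials: \<open>\<zeta>\<^sup>\<alpha>\<close> goes to \<open>\<zeta>\<^sup>\<beta>\<close> with
\<open>\<beta>\<^sub>i = \<alpha>\<^sub>1 + \<dots> + \<alpha>\<^sub>i + i - 1\<close>, where the \<open>i - 1\<close> comes from the Jacobian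
(\<open>laurent_monom_hartogs_map_inv\<close>). The inequalities that define the exponents of the Hartogs
triangle say exactly that all \<open>\<beta>\<^sub>i\<close> are nonnegative (\<open>index_shift_image\<close>), so the unitary
operator maps one Hardy space onto the other (\<open>class_wcomp_closed_span\<close>).

A unitary operator of \<open>L\<^sup>2\<close> that maps \<open>H\<close> onto \<open>K\<close> turns the orthogonal projection onto \<open>H\<close>
into the one onto \<open>K\<close>, and a weighted composition operator turns multiplication by \<open>\<phi>\<close> into
multiplication by \<open>\<phi> \<circ> h\<^bsup>-1\<^esup>\<close>.
Toeplitz operators are hence conjugate (\<open>toeplitz_class_wcomp\<close>), which is the first identity;
the second one is the first one for the symbol composed with \<open>hartogs_map n\<close>.

Two points need analysis. The projection is given by a definite description, so its
existence and uniqueness for the closed span of an orthonormal family have to be established;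
existence is the completeness of \<open>L\<^sup>2\<close> (\<open>riesz_fischer\<close>, \<open>square_summable_expansion\<close>,
\<open>unique_projection_closed_span\<close>). Invariance of the measure under \<open>hartogs_map_inv n\<close> is reduced
to rotation invariance of the circle by factoring the map into shears that multiply one
coordinate by another one (\<open>shear_preserving\<close>, \<open>partial_products_preserving\<close>).\<close>

section \<open>Inner product and norm of square-integrable functions\<close>

text \<open>Inner product and norm are taken on functions first, where the algebra needs no choice of
representatives; the operations on classes are computed from them afterwards.\<close>

definition inner_fun :: "'a measure \<Rightarrow> ('a \<Rightarrow> complex) \<Rightarrow> ('a \<Rightarrow> complex) \<Rightarrow> complex" where
  "inner_fun M f g = (LINT x|M. f x * cnj (g x))"

definition norm_fun :: "'a measure \<Rightarrow> ('a \<Rightarrow> complex) \<Rightarrow> real" where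
  "norm_fun M f = sqrt (LINT x|M. (norm (f x))\<^sup>2)"

lemma borel_measurable_cnj [measurable]:
  "f \<in> borel_measurable M \<Longrightarrow> (\<lambda>x. cnj (f x)) \<in> borel_measurable M"
  by (rule borel_measurable_continuous_on[of cnj]) (auto intro!: continuous_intros)

lemma L2_funI:
  "f \<in> borel_measurable M \<Longrightarrow> integrable M (\<lambda>x. (norm (f x))\<^sup>2) \<Longrightarrow> f \<in> L2_fun M"
  by (simp add: L2_fun_def)

lemma L2_fun_measurable: "f \<in> L2_fun M \<Longrightarrow> f \<in> borel_measurable M"
  and L2_fun_integrable: "f \<in> L2_fun M \<Longrightarrow> integrable M (\<lambda>x. (norm (f x))\<^sup>2)"
  by (simp_all add: L2_fun_def)

text \<open>Domination is how membership of \<open>L\<^sup>2\<close> is usually obtained: for scalar multiples,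
for multiples by bounded symbols, and for functions that agree with a known one on the
underlying space.\<close>

lemma L2_fun_bound:
  assumes "g \<in> L2_fun M" "f \<in> borel_measurable M" "AE x in M. norm (f x) \<le> C * norm (g x)"
  shows "f \<in> L2_fun M"
proof (rule L2_funI)
  show "integrable M (\<lambda>x. (norm (f x))\<^sup>2)"
  proof (rule Bochner_Integration.integrable_bound)
    show "integrable M (\<lambda>x. C\<^sup>2 * (norm (g x))\<^sup>2)"
      using L2_fun_integrable[OF assms(1)] by simp
    show "AE x in M. norm ((norm (f x))\<^sup>2) \<le> norm (C\<^sup>2 * (norm (g x))\<^sup>2)"
      using assms(3)
    proof eventually_elim
      case (elim x)
      then have "(norm (f x))\<^sup>2 \<le> (C * norm (g x))\<^sup>2" by (intro power_mono) auto
      then show ?case by (simp add: power_mult_distrib abs_mult)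
    qed
  qed (use assms(2) in measurable)
qed (fact assms(2))

lemma L2_fun_add:
  assumes "f \<in> L2_fun M" "g \<in> L2_fun M"
  shows "(\<lambda>x. f x + g x) \<in> L2_fun M"
proof (rule L2_funI)
  note [measurable] = assms[THEN L2_fun_measurable]
  show "(\<lambda>x. f x + g x) \<in> borel_measurable M" by measurable
  show "integrable M (\<lambda>x. (norm (f x + g x))\<^sup>2)"
  proof (rule Bochner_Integration.integrable_bound)
    show "integrable M (\<lambda>x. 2 * (norm (f x))\<^sup>2 + 2 * (norm (g x))\<^sup>2)"
      using assms[THEN L2_fun_integrable] by simp
    have "(norm (f x + g x))\<^sup>2 \<le> 2 * (norm (f x))\<^sup>2 + 2 * (norm (g x))\<^sup>2" for x
    proof -
      have "(norm (f x + g x))\<^sup>2 \<le> (norm (f x) + norm (g x))\<^sup>2"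
        by (intro power_mono norm_triangle_ineq) auto
      also have "\<dots> \<le> 2 * (norm (f x))\<^sup>2 + 2 * (norm (g x))\<^sup>2"
        using sum_squares_bound[of "norm (f x)" "norm (g x)"] by (simp add: power2_sum)
      finally show ?thesis .
    qed
    then show "AE x in M. norm ((norm (f x + g x))\<^sup>2)
        \<le> norm (2 * (norm (f x))\<^sup>2 + 2 * (norm (g x))\<^sup>2)"
      by simp
  qed measurable
qed

lemma L2_fun_scale:
  assumes "f \<in> L2_fun M"
  shows "(\<lambda>x. c * f x) \<in> L2_fun M"
proof (rule L2_fun_bound[OF assms])
  note [measurable] = L2_fun_measurable[OF assms]
  show "(\<lambda>x. c * f x) \<in> borel_measurable M" by measurable
  show "AE x in M. norm (c * f x) \<le> norm c * norm (f x)" by (simp add: norm_mult)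
qed

lemma L2_fun_diff: "f \<in> L2_fun M \<Longrightarrow> g \<in> L2_fun M \<Longrightarrow> (\<lambda>x. f x - g x) \<in> L2_fun M"
  using L2_fun_add[of f M "\<lambda>x. (-1) * g x"] L2_fun_scale[of g M "-1"] by simp

lemma L2_fun_zero: "(\<lambda>x. 0) \<in> L2_fun M"
  by (simp add: L2_fun_def)

lemma L2_fun_combination:
  "(\<And>i. i \<in> S \<Longrightarrow> e i \<in> L2_fun M) \<Longrightarrow> (\<lambda>x. \<Sum>i\<in>S. a i * e i x) \<in> L2_fun M"
  by (induction S rule: infinite_finite_induct) (auto simp: L2_fun_zero L2_fun_add L2_fun_scale)

lemma integrable_norm_mult_L2:
  assumes "f \<in> L2_fun M" "g \<in> L2_fun M"
  shows "integrable M (\<lambda>x. norm (f x) * norm (g x))"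
proof (rule Bochner_Integration.integrable_bound)
  note [measurable] = assms[THEN L2_fun_measurable]
  show "integrable M (\<lambda>x. (norm (f x))\<^sup>2 + (norm (g x))\<^sup>2)"
    using assms[THEN L2_fun_integrable] by simp
  show "AE x in M. norm (norm (f x) * norm (g x)) \<le> norm ((norm (f x))\<^sup>2 + (norm (g x))\<^sup>2)"
  proof (rule AE_I2)
    fix x
    show "norm (norm (f x) * norm (g x)) \<le> norm ((norm (f x))\<^sup>2 + (norm (g x))\<^sup>2)"
    proof -
      have "0 \<le> norm (f x) * norm (g x)" by simp
      with sum_squares_bound[of "norm (f x)" "norm (g x)"]
      have "norm (f x) * norm (g x) \<le> (norm (f x))\<^sup>2 + (norm (g x))\<^sup>2" by linarith
      then show ?thesis by simp
    qed
  qed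
  show "(\<lambda>x. norm (f x) * norm (g x)) \<in> borel_measurable M" by measurable
qed

lemma integrable_mult_cnj_L2:
  assumes "f \<in> L2_fun M" "g \<in> L2_fun M"
  shows "integrable M (\<lambda>x. f x * cnj (g x))"
proof (rule Bochner_Integration.integrable_bound[OF integrable_norm_mult_L2[OF assms]])
  note [measurable] = assms[THEN L2_fun_measurable]
  show "(\<lambda>x. f x * cnj (g x)) \<in> borel_measurable M" by measurable
qed (auto simp: norm_mult)

lemma norm_fun_nonneg: "0 \<le> norm_fun M f"
  by (simp add: norm_fun_def)

lemma norm_fun_square: "(norm_fun M f)\<^sup>2 = (LINT x|M. (norm (f x))\<^sup>2)"
  by (simp add: norm_fun_def)

lemma inner_fun_self: "inner_fun M f f = of_real ((norm_fun M f)\<^sup>2)"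
proof -
  have "inner_fun M f f = (LINT x|M. complex_of_real ((norm (f x))\<^sup>2))"
    unfolding inner_fun_def by (simp only: complex_norm_square)
  also have "\<dots> = of_real ((norm_fun M f)\<^sup>2)"
    by (simp only: norm_fun_square integral_complex_of_real)
  finally show ?thesis .
qed

lemma nn_integral_norm_fun:
  assumes "f \<in> L2_fun M"
  shows "(\<integral>\<^sup>+x. (ennreal (norm (f x)))\<^sup>2 \<partial>M) = ennreal ((norm_fun M f)\<^sup>2)"
  unfolding norm_fun_square using L2_fun_integrable[OF assms]
  by (subst nn_integral_eq_integral[symmetric]) (auto simp: ennreal_power)

text \<open>The Cauchy--Schwarz inequality with absolute values inside the integral. Both the bound on the
inner product and the triangle inequality are consequences.\<close>

lemma integral_norm_mult_le:
  assumes "f \<in> L2_fun M" "g \<in> L2_fun M"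
  shows "(LINT x|M. norm (f x) * norm (g x)) \<le> norm_fun M f * norm_fun M g"
proof -
  note [measurable] = assms[THEN L2_fun_measurable]
  let ?I = "LINT x|M. norm (f x) * norm (g x)"
  have I0: "0 \<le> ?I" by simp
  have "ennreal ?I = (\<integral>\<^sup>+x. ennreal (norm (f x) * norm (g x)) \<partial>M)"
    by (rule nn_integral_eq_integral[symmetric]) (auto intro: integrable_norm_mult_L2 assms)
  also have "\<dots> = (\<integral>\<^sup>+x. ennreal (norm (f x)) * ennreal (norm (g x)) \<partial>M)"
    by (intro nn_integral_cong ennreal_mult) auto
  finally have "ennreal (?I\<^sup>2) = (\<integral>\<^sup>+x. ennreal (norm (f x)) * ennreal (norm (g x)) \<partial>M)\<^sup>2"
    using ennreal_power[OF I0, of 2] by metis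
  also have "\<dots> \<le> (\<integral>\<^sup>+x. (ennreal (norm (f x)))\<^sup>2 \<partial>M) * (\<integral>\<^sup>+x. (ennreal (norm (g x)))\<^sup>2 \<partial>M)"
    by (rule Cauchy_Schwarz_nn_integral) measurable
  also have "\<dots> = ennreal ((norm_fun M f * norm_fun M g)\<^sup>2)"
    by (simp add: nn_integral_norm_fun assms power_mult_distrib ennreal_mult)
  finally have "?I\<^sup>2 \<le> (norm_fun M f * norm_fun M g)\<^sup>2" by (simp add: ennreal_le_iff)
  then show ?thesis by (rule power2_le_imp_le) (simp add: norm_fun_nonneg)
qed

lemma norm_inner_fun_le:
  assumes "f \<in> L2_fun M" "g \<in> L2_fun M"
  shows "norm (inner_fun M f g) \<le> norm_fun M f * norm_fun M g"
proof -
  have "norm (inner_fun M f g) \<le> (LINT x|M. norm (f x * cnj (g x)))"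
    unfolding inner_fun_def by (rule integral_norm_bound)
  also have "\<dots> \<le> norm_fun M f * norm_fun M g"
    using integral_norm_mult_le[OF assms] by (simp add: norm_mult)
  finally show ?thesis .
qed

lemma norm_fun_triangle:
  assumes "f \<in> L2_fun M" "g \<in> L2_fun M"
  shows "norm_fun M (\<lambda>x. f x + g x) \<le> norm_fun M f + norm_fun M g"
proof (rule power2_le_imp_le)
  have "(norm_fun M (\<lambda>x. f x + g x))\<^sup>2 \<le>
      (LINT x|M. (norm (f x))\<^sup>2 + (norm (g x))\<^sup>2 + 2 * (norm (f x) * norm (g x)))"
    unfolding norm_fun_square
  proof (rule integral_mono)
    show "integrable M (\<lambda>x. (norm (f x + g x))\<^sup>2)"
      using L2_fun_add[OF assms] by (rule L2_fun_integrable)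
    show "integrable M (\<lambda>x. (norm (f x))\<^sup>2 + (norm (g x))\<^sup>2 + 2 * (norm (f x) * norm (g x)))"
      using assms[THEN L2_fun_integrable] integrable_norm_mult_L2[OF assms] by auto
    fix x
    have "(norm (f x + g x))\<^sup>2 \<le> (norm (f x) + norm (g x))\<^sup>2"
      by (intro power_mono norm_triangle_ineq) auto
    then show "(norm (f x + g x))\<^sup>2 \<le>
        (norm (f x))\<^sup>2 + (norm (g x))\<^sup>2 + 2 * (norm (f x) * norm (g x))"
      by (simp add: power2_sum)
  qed
  also have "\<dots> = (norm_fun M f)\<^sup>2 + (norm_fun M g)\<^sup>2 + 2 * (LINT x|M. norm (f x) * norm (g x))"
    unfolding norm_fun_square
    using assms[THEN L2_fun_integrable] integrable_norm_mult_L2[OF assms] by simp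
  also have "\<dots> \<le> (norm_fun M f + norm_fun M g)\<^sup>2"
    using integral_norm_mult_le[OF assms] by (simp add: power2_sum)
  finally show "(norm_fun M (\<lambda>x. f x + g x))\<^sup>2 \<le> (norm_fun M f + norm_fun M g)\<^sup>2" .
qed (simp add: norm_fun_nonneg)

lemma norm_fun_minus_commute: "norm_fun M (\<lambda>x. f x - g x) = norm_fun M (\<lambda>x. g x - f x)"
  by (simp add: norm_fun_def norm_minus_commute)

lemma norm_fun_diff_triangle:
  assumes "f \<in> L2_fun M" "g \<in> L2_fun M" "h \<in> L2_fun M"
  shows "norm_fun M (\<lambda>x. f x - h x) \<le> norm_fun M (\<lambda>x. f x - g x) + norm_fun M (\<lambda>x. g x - h x)"
  using norm_fun_triangle[OF L2_fun_diff[OF assms(1,2)] L2_fun_diff[OF assms(2,3)]] by simp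

lemma inner_fun_cnj: "cnj (inner_fun M f g) = inner_fun M g f"
proof -
  have "cnj (inner_fun M f g) = (LINT x|M. cnj (f x * cnj (g x)))"
    unfolding inner_fun_def by (rule Bochner_Integration.integral_cnj[symmetric])
  also have "\<dots> = inner_fun M g f"
    unfolding inner_fun_def by (intro Bochner_Integration.integral_cong) (auto simp: mult.commute)
  finally show ?thesis .
qed

lemma inner_fun_diff_left:
  "f \<in> L2_fun M \<Longrightarrow> g \<in> L2_fun M \<Longrightarrow> h \<in> L2_fun M
    \<Longrightarrow> inner_fun M (\<lambda>x. f x - g x) h = inner_fun M f h - inner_fun M g h"
  by (simp add: inner_fun_def left_diff_distrib integrable_mult_cnj_L2)

lemma inner_fun_diff_right:
  "f \<in> L2_fun M \<Longrightarrow> g \<in> L2_fun M \<Longrightarrow> h \<in> L2_fun M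
    \<Longrightarrow> inner_fun M h (\<lambda>x. f x - g x) = inner_fun M h f - inner_fun M h g"
  using inner_fun_diff_left[of f M g h] by (simp flip: inner_fun_cnj[of M _ h])

lemma inner_fun_combination_left:
  assumes "\<And>i. i \<in> S \<Longrightarrow> e i \<in> L2_fun M" "g \<in> L2_fun M"
  shows "inner_fun M (\<lambda>x. \<Sum>i\<in>S. a i * e i x) g = (\<Sum>i\<in>S. a i * inner_fun M (e i) g)"
  unfolding inner_fun_def using integrable_mult_cnj_L2[OF assms]
  by (simp add: sum_distrib_right mult.assoc)

lemma inner_fun_combination_right:
  assumes "\<And>i. i \<in> S \<Longrightarrow> e i \<in> L2_fun M" "g \<in> L2_fun M"
  shows "inner_fun M g (\<lambda>x. \<Sum>i\<in>S. a i * e i x) = (\<Sum>i\<in>S. cnj (a i) * inner_fun M g (e i))"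
proof -
  have "inner_fun M g (\<lambda>x. \<Sum>i\<in>S. a i * e i x) = cnj (inner_fun M (\<lambda>x. \<Sum>i\<in>S. a i * e i x) g)"
    by (simp add: inner_fun_cnj)
  also have "\<dots> = cnj (\<Sum>i\<in>S. a i * inner_fun M (e i) g)"
    by (subst inner_fun_combination_left) (use assms in auto)
  also have "\<dots> = (\<Sum>i\<in>S. cnj (a i) * inner_fun M g (e i))"
    by (simp add: inner_fun_cnj)
  finally show ?thesis .
qed

lemma norm_fun_eq_0_AE:
  assumes "f \<in> L2_fun M" "norm_fun M f = 0"
  shows "AE x in M. f x = 0"
proof -
  have "(LINT x|M. (norm (f x))\<^sup>2) = 0"
    using assms(2) norm_fun_square[of M f] by simp
  then have "AE x in M. (norm (f x))\<^sup>2 = 0"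
    using integral_nonneg_eq_0_iff_AE[OF L2_fun_integrable[OF assms(1)]] by simp
  then show ?thesis by simp
qed

lemma (in finite_measure) bounded_in_L2_fun:
  assumes "f \<in> borel_measurable M" "\<And>x. x \<in> space M \<Longrightarrow> norm (f x) \<le> C"
  shows "f \<in> L2_fun M"
proof (rule L2_fun_bound[where g = "\<lambda>_. 1" and C = C])
  show "(\<lambda>_. 1) \<in> L2_fun M" by (simp add: L2_fun_def)
  show "f \<in> borel_measurable M" by (fact assms(1))
  show "AE x in M. norm (f x) \<le> C * norm (1 :: complex)"
    by (intro AE_I2) (use assms(2) in simp)
qed

lemma bounded_mult_in_L2:
  assumes "\<phi> \<in> Linfty_fun M" "f \<in> L2_fun M"
  shows "(\<lambda>x. \<phi> x * f x) \<in> L2_fun M"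
proof -
  obtain C where C: "\<phi> \<in> borel_measurable M" "AE x in M. norm (\<phi> x) \<le> C"
    using assms(1) by (auto simp: Linfty_fun_def)
  note [measurable] = C(1) L2_fun_measurable[OF assms(2)]
  show ?thesis
  proof (rule L2_fun_bound[OF assms(2)])
    show "AE x in M. norm (\<phi> x * f x) \<le> C * norm (f x)"
      using C(2) by eventually_elim (simp add: norm_mult mult_right_mono)
  qed measurable
qed

section \<open>Completeness\<close>

text \<open>On a finite measure space the \<open>L\<^sup>1\<close> norm is at most a constant times the \<open>L\<^sup>2\<close> norm, so the
increments of a sequence with geometrically small steps are absolutely summable almost everywhere
and the sequence converges pointwise there. Fatou's lemma turns the pointwise limit into an \<open>L\<^sup>2\<close>
limit with an explicit rate. This form of completeness suffices, since the partial
sums of an orthonormal series over suitable finite sets have such steps.\<close>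

lemma (in finite_measure) riesz_fischer:
  assumes f: "\<And>k. f k \<in> L2_fun M"
    and step: "\<And>k. norm_fun M (\<lambda>x. f (Suc k) x - f k x) \<le> (1/2) ^ k"
  obtains F where "F \<in> L2_fun M" "\<And>m. norm_fun M (\<lambda>x. F x - f m x) \<le> 2 * (1/2) ^ m"
proof -
  note [measurable] = f[THEN L2_fun_measurable]
  have one: "(\<lambda>_. 1) \<in> L2_fun M" by (rule bounded_in_L2_fun[of _ 1]) auto
  define C where "C = norm_fun M (\<lambda>_. 1)"
  have diff: "(\<lambda>x. f (Suc k) x - f k x) \<in> L2_fun M" for k by (intro L2_fun_diff f)
  \<comment> \<open>Cauchy--Schwarz against the constant \<open>1\<close> compares the \<open>L\<^sup>1\<close> norm with the \<open>L\<^sup>2\<close> norm.\<close>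
  have L1: "(\<integral>\<^sup>+x. ennreal (norm (f (Suc k) x - f k x)) \<partial>M) \<le> ennreal (C * (1/2) ^ k)" for k
  proof -
    have "(LINT x|M. norm (f (Suc k) x - f k x)) \<le> norm_fun M (\<lambda>x. f (Suc k) x - f k x) * C"
      unfolding C_def using integral_norm_mult_le[OF diff one] by simp
    also have "\<dots> \<le> C * (1/2) ^ k"
      using mult_right_mono[OF step[of k] norm_fun_nonneg[of M "\<lambda>_. 1"]]
      by (simp add: C_def mult.commute)
    finally have "(LINT x|M. norm (f (Suc k) x - f k x)) \<le> C * (1/2) ^ k" .
    moreover have "integrable M (\<lambda>x. norm (f (Suc k) x - f k x))"
      using integrable_norm_mult_L2[OF diff one] by simp
    ultimately show ?thesis
      by (subst nn_integral_eq_integral) (auto intro: ennreal_leI)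
  qed
  have "(\<integral>\<^sup>+x. (\<Sum>k. ennreal (norm (f (Suc k) x - f k x))) \<partial>M)
      = (\<Sum>k. \<integral>\<^sup>+x. ennreal (norm (f (Suc k) x - f k x)) \<partial>M)"
    by (intro nn_integral_suminf) measurable
  also have "\<dots> \<le> (\<Sum>k. ennreal (C * (1/2) ^ k))"
    by (intro suminf_le L1) auto
  also have "\<dots> = ennreal (\<Sum>k. C * (1/2) ^ k)"
    by (intro suminf_ennreal2) (auto simp: C_def norm_fun_nonneg intro!: summable_mult summable_geometric)
  finally have "(\<integral>\<^sup>+x. (\<Sum>k. ennreal (norm (f (Suc k) x - f k x))) \<partial>M) \<noteq> \<infinity>"
    by (auto simp: top_unique)
  then have "AE x in M. (\<Sum>k. ennreal (norm (f (Suc k) x - f k x))) \<noteq> \<infinity>"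
    by (intro nn_integral_PInf_AE) measurable
  then have conv: "AE x in M. convergent (\<lambda>k. f k x)"
  proof eventually_elim
    case (elim x)
    then have "summable (\<lambda>k. norm (f (Suc k) x - f k x))"
      by (intro summable_suminf_not_top) auto
    then have "summable (\<lambda>k. f (Suc k) x - f k x)" by (rule summable_norm_cancel)
    then have "convergent (\<lambda>n. \<Sum>k<n. f (Suc k) x - f k x)" by (simp add: summable_iff_convergent)
    then have "convergent (\<lambda>n. f n x - f 0 x)"
      by (subst (asm) sum_lessThan_telescope[of "\<lambda>k. f k x"])
    then show ?case by (simp add: convergent_diff_const_right_iff)
  qed
  define F where "F = (\<lambda>x. lim (\<lambda>k. f k x))"
  have F_meas [measurable]: "F \<in> borel_measurable M"
    unfolding F_def by (rule borel_measurable_lim_metric) measurable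
  have far: "norm_fun M (\<lambda>x. f (m + j) x - f m x) \<le> 2 * (1/2) ^ m" for m j
  proof -
    \<comment> \<open>The bound is the sum of the steps from \<open>m\<close> to \<open>m + j\<close>, kept exact so that the induction closes.\<close>
    have "norm_fun M (\<lambda>x. f (m + j) x - f m x) \<le> 2 * (1/2) ^ m - 2 * (1/2) ^ (m + j)"
    proof (induction j)
      case 0
      then show ?case by (simp add: norm_fun_def)
    next
      case (Suc j)
      have "norm_fun M (\<lambda>x. f (m + Suc j) x - f m x) \<le>
          norm_fun M (\<lambda>x. f (m + Suc j) x - f (m + j) x) + norm_fun M (\<lambda>x. f (m + j) x - f m x)"
        by (intro norm_fun_diff_triangle f)
      also have "\<dots> \<le> (1/2) ^ (m + j) + (2 * (1/2) ^ m - 2 * (1/2) ^ (m + j))"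
        using step[of "m + j"] Suc by (intro add_mono) auto
      finally show ?case by simp
    qed
    also have "\<dots> \<le> 2 * (1/2) ^ m" by simp
    finally show ?thesis .
  qed
  have fatou: "(\<integral>\<^sup>+x. ennreal ((norm (F x - f m x))\<^sup>2) \<partial>M) \<le> ennreal ((2 * (1/2) ^ m)\<^sup>2)" for m
  proof -
    have "(\<integral>\<^sup>+x. ennreal ((norm (F x - f m x))\<^sup>2) \<partial>M)
        = (\<integral>\<^sup>+x. liminf (\<lambda>j. ennreal ((norm (f (m + j) x - f m x))\<^sup>2)) \<partial>M)"
    proof (rule nn_integral_cong_AE)
      show "AE x in M. ennreal ((norm (F x - f m x))\<^sup>2)
          = liminf (\<lambda>j. ennreal ((norm (f (m + j) x - f m x))\<^sup>2))"
        using conv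
      proof eventually_elim
        case (elim x)
        then have "(\<lambda>k. f k x) \<longlonglongrightarrow> F x" by (simp add: F_def convergent_LIMSEQ_iff)
        then have "(\<lambda>j. f (m + j) x) \<longlonglongrightarrow> F x"
          by (subst add.commute) (rule LIMSEQ_ignore_initial_segment)
        then have "(\<lambda>j. ennreal ((norm (f (m + j) x - f m x))\<^sup>2))
            \<longlonglongrightarrow> ennreal ((norm (F x - f m x))\<^sup>2)"
          by (intro tendsto_intros tendsto_ennrealI)
        then show ?case by (rule lim_imp_Liminf[OF sequentially_bot, symmetric])
      qed
    qed
    also have "\<dots> \<le> liminf (\<lambda>j. \<integral>\<^sup>+x. ennreal ((norm (f (m + j) x - f m x))\<^sup>2) \<partial>M)"
      by (rule nn_integral_liminf) measurable
    also have "\<dots> \<le> liminf (\<lambda>j. ennreal ((2 * (1/2) ^ m)\<^sup>2))"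
    proof (intro Liminf_mono always_eventually allI)
      fix j
      have "(\<integral>\<^sup>+x. ennreal ((norm (f (m + j) x - f m x))\<^sup>2) \<partial>M)
          = ennreal ((norm_fun M (\<lambda>x. f (m + j) x - f m x))\<^sup>2)"
        using nn_integral_norm_fun[OF L2_fun_diff[OF f f]] by (simp add: ennreal_power)
      also have "\<dots> \<le> ennreal ((2 * (1/2) ^ m)\<^sup>2)"
        by (intro ennreal_leI power_mono far norm_fun_nonneg)
      finally show "(\<integral>\<^sup>+x. ennreal ((norm (f (m + j) x - f m x))\<^sup>2) \<partial>M)
          \<le> ennreal ((2 * (1/2) ^ m)\<^sup>2)" .
    qed
    finally show ?thesis by (simp add: Liminf_const)
  qed
  have diffF: "(\<lambda>x. F x - f m x) \<in> L2_fun M" for m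
  proof (rule L2_funI)
    have "(\<integral>\<^sup>+x. ennreal (norm ((norm (F x - f m x))\<^sup>2)) \<partial>M) < \<infinity>"
      using fatou[of m] by (auto simp: top_unique less_top[symmetric])
    then show "integrable M (\<lambda>x. (norm (F x - f m x))\<^sup>2)"
      by (intro integrableI_bounded) measurable
  qed measurable
  show ?thesis
  proof
    show "F \<in> L2_fun M" using L2_fun_add[OF diffF[of 0] f[of 0]] by simp
    fix m
    have "ennreal ((norm_fun M (\<lambda>x. F x - f m x))\<^sup>2) \<le> ennreal ((2 * (1/2) ^ m)\<^sup>2)"
      using fatou[of m] nn_integral_norm_fun[OF diffF[of m]] by (simp add: ennreal_power)
    then have "(norm_fun M (\<lambda>x. F x - f m x))\<^sup>2 \<le> (2 * (1/2) ^ m)\<^sup>2"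
      by (simp add: ennreal_le_iff)
    then show "norm_fun M (\<lambda>x. F x - f m x) \<le> 2 * (1/2) ^ m"
      by (rule power2_le_imp_le) simp
  qed
qed

section \<open>Orthonormal expansions\<close>

text \<open>The family \<open>e\<close> may be defined beyond \<open>A\<close>; only its members with index in \<open>A\<close> are constrained. For
the Hardy spaces \<open>e\<close> is the family of all Laurent monomials and \<open>A\<close> the set of exponents.\<close>

locale orthonormal_family = finite_measure M for M :: "'a measure" +
  fixes e :: "'i \<Rightarrow> 'a \<Rightarrow> complex" and A :: "'i set"
  assumes in_L2: "i \<in> A \<Longrightarrow> e i \<in> L2_fun M"
    and orthonormal: "i \<in> A \<Longrightarrow> j \<in> A \<Longrightarrow> inner_fun M (e i) (e j) = (if i = j then 1 else 0)"
begin

text \<open>Convergence is unordered, along the finite subsets of \<open>A\<close>, because the exponents carry no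
preferred enumeration.\<close>

definition expansion :: "('a \<Rightarrow> complex) \<Rightarrow> ('i \<Rightarrow> complex) \<Rightarrow> bool" where
  "expansion f a \<longleftrightarrow>
     ((\<lambda>S. norm_fun M (\<lambda>x. f x - (\<Sum>i\<in>S. a i * e i x))) \<longlongrightarrow> 0) (finite_subsets_at_top A)"

lemma combination_in_L2: "S \<subseteq> A \<Longrightarrow> (\<lambda>x. \<Sum>i\<in>S. a i * e i x) \<in> L2_fun M"
  using in_L2 by (intro L2_fun_combination) blast

lemma inner_fun_combination_e:
  assumes "finite S" "S \<subseteq> A" "j \<in> A"
  shows "inner_fun M (\<lambda>x. \<Sum>i\<in>S. a i * e i x) (e j) = (if j \<in> S then a j else 0)"
proof -
  have "inner_fun M (\<lambda>x. \<Sum>i\<in>S. a i * e i x) (e j) = (\<Sum>i\<in>S. a i * inner_fun M (e i) (e j))"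
    using assms by (intro inner_fun_combination_left) (auto intro: in_L2)
  also have "\<dots> = (\<Sum>i\<in>S. if j = i then a i else 0)"
    using assms by (intro sum.cong) (auto simp: orthonormal)
  finally show ?thesis using assms(1) by simp
qed

lemma norm_fun_combination:
  assumes "finite S" "S \<subseteq> A"
  shows "(norm_fun M (\<lambda>x. \<Sum>i\<in>S. a i * e i x))\<^sup>2 = (\<Sum>i\<in>S. (norm (a i))\<^sup>2)"
proof -
  let ?g = "\<lambda>x. \<Sum>i\<in>S. a i * e i x"
  have "complex_of_real ((norm_fun M ?g)\<^sup>2) = inner_fun M ?g ?g" by (simp only: inner_fun_self)
  also have "\<dots> = (\<Sum>i\<in>S. cnj (a i) * inner_fun M ?g (e i))"
    using assms by (intro inner_fun_combination_right combination_in_L2) (auto intro: in_L2)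
  also have "\<dots> = (\<Sum>i\<in>S. complex_of_real ((norm (a i))\<^sup>2))"
  proof (rule sum.cong)
    fix i assume "i \<in> S"
    then have "inner_fun M ?g (e i) = a i" using assms inner_fun_combination_e[of S i a] by auto
    then show "cnj (a i) * inner_fun M ?g (e i) = complex_of_real ((norm (a i))\<^sup>2)"
      by (simp only: complex_norm_square mult.commute)
  qed simp
  also have "\<dots> = complex_of_real (\<Sum>i\<in>S. (norm (a i))\<^sup>2)" by simp
  finally show ?thesis by (simp only: of_real_eq_iff)
qed

text \<open>The difference between \<open>f\<close> and its projection onto a finite part of the family has squared norm
\<open>\<parallel>f\<parallel>\<^sup>2 - \<Sum> |\<langle>f, e\<^sub>i\<rangle>|\<^sup>2\<close>, which cannot be negative.\<close>

lemma bessel: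
  assumes "f \<in> L2_fun M" "finite S" "S \<subseteq> A"
  shows "(\<Sum>i\<in>S. (norm (inner_fun M f (e i)))\<^sup>2) \<le> (norm_fun M f)\<^sup>2"
proof -
  define a where "a i = inner_fun M f (e i)" for i
  let ?g = "\<lambda>x. \<Sum>i\<in>S. a i * e i x"
  let ?B = "\<Sum>i\<in>S. (norm (a i))\<^sup>2"
  have g: "?g \<in> L2_fun M" by (rule combination_in_L2) fact
  have gg: "inner_fun M ?g ?g = of_real ?B"
    using norm_fun_combination[OF assms(2,3), of a] by (simp only: inner_fun_self)
  have "inner_fun M f ?g = (\<Sum>i\<in>S. cnj (a i) * inner_fun M f (e i))"
    using assms by (intro inner_fun_combination_right) (auto intro: in_L2)
  also have "\<dots> = (\<Sum>i\<in>S. complex_of_real ((norm (a i))\<^sup>2))"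
    by (intro sum.cong refl) (simp only: complex_norm_square mult.commute a_def)
  finally have fg: "inner_fun M f ?g = of_real ?B" by simp
  have gf: "inner_fun M ?g f = of_real ?B"
    using arg_cong[OF fg, of cnj] by (simp only: inner_fun_cnj complex_cnj_complex_of_real)
  have "inner_fun M (\<lambda>x. f x - ?g x) (\<lambda>x. f x - ?g x)
      = inner_fun M f f - inner_fun M ?g f - (inner_fun M f ?g - inner_fun M ?g ?g)"
    using assms(1) g L2_fun_diff[OF assms(1) g] by (simp add: inner_fun_diff_left inner_fun_diff_right)
  also have "\<dots> = of_real ((norm_fun M f)\<^sup>2 - ?B)"
    unfolding fg gf gg by (simp add: inner_fun_self)
  finally have "(norm_fun M (\<lambda>x. f x - ?g x))\<^sup>2 = (norm_fun M f)\<^sup>2 - ?B"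
    by (simp only: inner_fun_self of_real_eq_iff)
  moreover have "0 \<le> (norm_fun M (\<lambda>x. f x - ?g x))\<^sup>2" by simp
  ultimately show ?thesis by (simp add: a_def)
qed

lemma summable_coefficients:
  assumes "f \<in> L2_fun M"
  shows "(\<lambda>i. (norm (inner_fun M f (e i)))\<^sup>2) summable_on A"
proof (rule nonneg_bdd_above_summable_on)
  show "bdd_above (sum (\<lambda>i. (norm (inner_fun M f (e i)))\<^sup>2) ` {S. S \<subseteq> A \<and> finite S})"
    using bessel[OF assms] by (intro bdd_aboveI[of _ "(norm_fun M f)\<^sup>2"]) blast
qed simp

text \<open>Finite sets \<open>T\<^sub>k\<close> are chosen that capture the sum of the \<open>|a\<^sub>i|\<^sup>2\<close> up to \<open>4\<^bsup>-k\<^esup>\<close>. By orthonormality the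
partial sum over any larger finite set is within \<open>2\<^bsup>-k\<^esup>\<close> of the one over \<open>T\<^sub>k\<close>, so the
partial sums over the \<open>T\<^sub>k\<close> have a limit by completeness, and the whole net follows it.\<close>

lemma square_summable_expansion:
  assumes "(\<lambda>i. (norm (a i))\<^sup>2) summable_on A"
  obtains f where "f \<in> L2_fun M" "expansion f a"
proof -
  let ?q = "\<lambda>i. (norm (a i))\<^sup>2"
  let ?g = "\<lambda>S x. \<Sum>i\<in>S. a i * e i x"
  define s where "s = infsum ?q A"
  have le_s: "sum ?q T \<le> s" if "finite T" "T \<subseteq> A" for T
    unfolding s_def using that by (intro finite_sum_le_infsum assms) auto
  have "\<exists>S. finite S \<and> S \<subseteq> A \<and> s - (1/4) ^ k \<le> sum ?q S" for k :: nat
  proof -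
    obtain S where "finite S" "S \<subseteq> A" "dist (sum ?q S) s \<le> (1/4) ^ k"
      using infsum_finite_approximation[OF assms, of "(1/4) ^ k"] by (auto simp: s_def)
    then show ?thesis by (intro exI[of _ S]) (auto simp: dist_real_def abs_le_iff)
  qed
  then obtain S where S: "\<And>k. finite (S k)" "\<And>k. S k \<subseteq> A" "\<And>k. s - (1/4) ^ k \<le> sum ?q (S k)"
    by metis
  \<comment> \<open>The sets \<open>S k\<close> need not be nested; their unions are.\<close>
  define T where "T k = (\<Union>i\<le>k. S i)" for k :: nat
  have T: "finite (T k)" "T k \<subseteq> A" "T k \<subseteq> T (Suc k)" "S k \<subseteq> T k" for k
    using S(1,2) by (auto simp: T_def atMost_Suc)
  have tail: "norm_fun M (\<lambda>x. ?g R x - ?g (T k) x) \<le> (1/2) ^ k"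
    if R: "finite R" "R \<subseteq> A" "T k \<subseteq> R" for R k
  proof -
    have "(\<lambda>x. ?g R x - ?g (T k) x) = ?g (R - T k)"
      using R by (simp add: sum_diff fun_eq_iff)
    then have "(norm_fun M (\<lambda>x. ?g R x - ?g (T k) x))\<^sup>2 = sum ?q (R - T k)"
      using R norm_fun_combination[of "R - T k" a] by auto
    also have "\<dots> = sum ?q R - sum ?q (T k)" using R by (simp add: sum_diff)
    also have "\<dots> \<le> (1/4) ^ k"
    proof -
      have "sum ?q (S k) \<le> sum ?q (T k)" by (intro sum_mono2 T) auto
      then show ?thesis using le_s[OF R(1,2)] S(3)[of k] by linarith
    qed
    also have "\<dots> = ((1/2 :: real) ^ k)\<^sup>2"
      by (simp add: power2_eq_square flip: power_mult_distrib)
    finally show ?thesis by (rule power2_le_imp_le) simp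
  qed
  obtain F where F: "F \<in> L2_fun M" "\<And>m. norm_fun M (\<lambda>x. F x - ?g (T m) x) \<le> 2 * (1/2) ^ m"
    using riesz_fischer[of "\<lambda>k. ?g (T k)"] combination_in_L2[OF T(2)] tail[OF T(1,2,3)] by metis
  have "expansion F a"
    unfolding expansion_def
  proof (rule tendstoI)
    fix \<epsilon> :: real assume "0 < \<epsilon>"
    then obtain k where k: "(1/2 :: real) ^ k < \<epsilon> / 3"
      using real_arch_pow_inv[of "\<epsilon> / 3" "1/2"] by auto
    show "\<forall>\<^sub>F R in finite_subsets_at_top A. dist (norm_fun M (\<lambda>x. F x - ?g R x)) 0 < \<epsilon>"
      unfolding eventually_finite_subsets_at_top
    proof (intro exI[of _ "T k"] conjI allI impI T(1,2))
      fix R assume R: "finite R \<and> T k \<subseteq> R \<and> R \<subseteq> A"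
      have "norm_fun M (\<lambda>x. F x - ?g R x) \<le>
          norm_fun M (\<lambda>x. F x - ?g (T k) x) + norm_fun M (\<lambda>x. ?g (T k) x - ?g R x)"
        using R T by (intro norm_fun_diff_triangle F combination_in_L2) auto
      also have "\<dots> \<le> 2 * (1/2) ^ k + (1/2) ^ k"
        using F(2)[of k] tail[of R k] R by (simp add: norm_fun_minus_commute[of M "?g (T k)"])
      also have "\<dots> < \<epsilon>" using k by simp
      finally show "dist (norm_fun M (\<lambda>x. F x - ?g R x)) 0 < \<epsilon>"
        by (simp add: norm_fun_nonneg)
    qed
  qed
  with F(1) that show ?thesis by blast
qed

text \<open>Continuity of the inner product; it reduces statements about a limit to finite combinations.\<close>

lemma expansion_inner:
  assumes "expansion f a" "f \<in> L2_fun M" "g \<in> L2_fun M"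
  shows "((\<lambda>S. inner_fun M (\<lambda>x. \<Sum>i\<in>S. a i * e i x) g) \<longlongrightarrow> inner_fun M f g) (finite_subsets_at_top A)"
proof -
  let ?s = "\<lambda>S x. \<Sum>i\<in>S. a i * e i x"
  have "((\<lambda>S. inner_fun M f g - inner_fun M (?s S) g) \<longlongrightarrow> 0) (finite_subsets_at_top A)"
  proof (rule Lim_null_comparison)
    show "((\<lambda>S. norm_fun M (\<lambda>x. f x - ?s S x) * norm_fun M g) \<longlongrightarrow> 0) (finite_subsets_at_top A)"
      using assms(1) unfolding expansion_def by (rule tendsto_mult_left_zero)
    show "\<forall>\<^sub>F S in finite_subsets_at_top A.
        norm (inner_fun M f g - inner_fun M (?s S) g) \<le> norm_fun M (\<lambda>x. f x - ?s S x) * norm_fun M g"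
    proof (rule eventually_finite_subsets_at_top_weakI)
      fix S assume S: "finite S" "S \<subseteq> A"
      note s = combination_in_L2[OF S(2), of a]
      show "norm (inner_fun M f g - inner_fun M (?s S) g) \<le> norm_fun M (\<lambda>x. f x - ?s S x) * norm_fun M g"
        using norm_inner_fun_le[OF L2_fun_diff[OF assms(2) s] assms(3)]
        by (simp add: inner_fun_diff_left[OF assms(2) s assms(3)])
    qed
  qed
  then show ?thesis by (rule Lim_transform2[OF tendsto_const])
qed

lemma expansion_coefficient:
  assumes "expansion f a" "f \<in> L2_fun M" "j \<in> A"
  shows "inner_fun M f (e j) = a j"
proof -
  have "\<forall>\<^sub>F S in finite_subsets_at_top A. inner_fun M (\<lambda>x. \<Sum>i\<in>S. a i * e i x) (e j) = a j"
    unfolding eventually_finite_subsets_at_top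
    using assms(3) by (intro exI[of _ "{j}"]) (auto simp: inner_fun_combination_e)
  then have "((\<lambda>S. inner_fun M (\<lambda>x. \<Sum>i\<in>S. a i * e i x) (e j)) \<longlongrightarrow> a j) (finite_subsets_at_top A)"
    by (rule tendsto_eventually)
  with expansion_inner[OF assms(1,2) in_L2[OF assms(3)]] show ?thesis
    by (rule tendsto_unique[OF finite_subsets_at_top_neq_bot])
qed

lemma expansion_orthogonal:
  assumes "expansion f a" "f \<in> L2_fun M" "g \<in> L2_fun M" "\<And>i. i \<in> A \<Longrightarrow> inner_fun M g (e i) = 0"
  shows "inner_fun M g f = 0"
proof -
  have e: "inner_fun M (e i) g = 0" if "i \<in> A" for i
    using assms(4)[OF that] inner_fun_cnj[of M g "e i"] by simp
  have "\<forall>\<^sub>F S in finite_subsets_at_top A. inner_fun M (\<lambda>x. \<Sum>i\<in>S. a i * e i x) g = 0"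
  proof (rule eventually_finite_subsets_at_top_weakI)
    fix S assume "S \<subseteq> A"
    then have "inner_fun M (\<lambda>x. \<Sum>i\<in>S. a i * e i x) g = (\<Sum>i\<in>S. a i * inner_fun M (e i) g)"
      by (intro inner_fun_combination_left assms) (auto intro: in_L2)
    also have "\<dots> = 0" using e \<open>S \<subseteq> A\<close> by (intro sum.neutral) auto
    finally show "inner_fun M (\<lambda>x. \<Sum>i\<in>S. a i * e i x) g = 0" .
  qed
  then have "((\<lambda>S. inner_fun M (\<lambda>x. \<Sum>i\<in>S. a i * e i x) g) \<longlongrightarrow> 0) (finite_subsets_at_top A)"
    by (rule tendsto_eventually)
  with expansion_inner[OF assms(1-3)] have "inner_fun M f g = 0"
    by (rule tendsto_unique[OF finite_subsets_at_top_neq_bot])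
  then show ?thesis using inner_fun_cnj[of M f g] by simp
qed

lemma expansion_e:
  assumes "j \<in> A"
  shows "expansion (e j) (\<lambda>i. if i = j then 1 else 0)"
proof -
  have "\<forall>\<^sub>F S in finite_subsets_at_top A.
      norm_fun M (\<lambda>x. e j x - (\<Sum>i\<in>S. (if i = j then 1 else 0) * e i x)) = 0"
    unfolding eventually_finite_subsets_at_top
  proof (intro exI[of _ "{j}"] conjI allI impI)
    fix S assume S: "finite S \<and> {j} \<subseteq> S \<and> S \<subseteq> A"
    then have "(\<Sum>i\<in>S. (if i = j then 1 else 0) * e i x) = e j x" for x
      by (simp add: if_distrib[of "\<lambda>c. c * _"] cong: if_cong)
    then show "norm_fun M (\<lambda>x. e j x - (\<Sum>i\<in>S. (if i = j then 1 else 0) * e i x)) = 0"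
      by (simp add: norm_fun_def)
  qed (use assms in auto)
  then show ?thesis unfolding expansion_def by (rule tendsto_eventually)
qed

end

section \<open>Classes modulo equality almost everywhere\<close>

lemma equiv_L2_rel: "equiv (L2_fun M) (L2_rel M)"
proof (rule equivI)
  show "L2_rel M \<subseteq> L2_fun M \<times> L2_fun M" by (auto simp: L2_rel_def)
  show "refl_on (L2_fun M) (L2_rel M)" by (auto simp: L2_rel_def refl_on_def)
  show "sym (L2_rel M)" by (auto simp: L2_rel_def sym_def)
  show "trans (L2_rel M)" by (auto simp: L2_rel_def trans_def)
qed

lemma L2_class_in_L2: "f \<in> L2_fun M \<Longrightarrow> L2_class M f \<in> L2 M"
  unfolding L2_class_def L2_def by (rule quotientI)

lemma L2_cases:
  assumes "F \<in> L2 M"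
  obtains f where "f \<in> L2_fun M" "F = L2_class M f"
  using assms unfolding L2_def L2_class_def by (rule quotientE)

lemma L2_rep_mem:
  assumes "F \<in> L2 M"
  shows "L2_rep F \<in> F"
proof -
  obtain f where f: "f \<in> L2_fun M" "F = L2_class M f" using assms by (rule L2_cases)
  then have "f \<in> F" by (simp add: L2_class_def L2_rel_def)
  then show ?thesis unfolding L2_rep_def by (rule someI[of "\<lambda>g. g \<in> F"])
qed

lemma L2_rep_in_L2_fun:
  assumes "F \<in> L2 M"
  shows "L2_rep F \<in> L2_fun M"
proof -
  have "F \<subseteq> L2_fun M"
    using assms unfolding L2_def by (rule in_quotient_imp_subset[OF equiv_L2_rel])
  then show ?thesis using L2_rep_mem[OF assms] by blast
qed

lemma L2_class_eqI:
  assumes "f \<in> L2_fun M" "g \<in> L2_fun M" "AE x in M. f x = g x"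
  shows "L2_class M f = L2_class M g"
proof -
  have "(f, g) \<in> L2_rel M" using assms by (simp add: L2_rel_def)
  then show ?thesis unfolding L2_class_def by (rule equiv_class_eq[OF equiv_L2_rel])
qed

lemma L2_class_eqD:
  assumes "f \<in> L2_fun M" "g \<in> L2_fun M" "L2_class M f = L2_class M g"
  shows "AE x in M. f x = g x"
proof -
  have "(f, g) \<in> L2_rel M"
    using assms(3) unfolding L2_class_def by (rule eq_equiv_class[OF _ equiv_L2_rel assms(2)])
  then show ?thesis by (simp add: L2_rel_def)
qed

lemma L2_class_rep:
  assumes "F \<in> L2 M"
  shows "L2_class M (L2_rep F) = F"
proof -
  obtain f where f: "f \<in> L2_fun M" "F = L2_class M f" using assms by (rule L2_cases)
  then have "(f, L2_rep F) \<in> L2_rel M" using L2_rep_mem[OF assms] by (simp add: L2_class_def)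
  then show ?thesis
    using equiv_class_eq[OF equiv_L2_rel] f(2) by (auto simp: L2_class_def)
qed

text \<open>Together with \<open>L2_cases\<close> this lets every operation on classes be evaluated on an arbitrary
representative instead of the chosen one.\<close>

lemma L2_rep_class:
  assumes "f \<in> L2_fun M"
  shows "AE x in M. L2_rep (L2_class M f) x = f x"
  using L2_rep_in_L2_fun[OF L2_class_in_L2[OF assms]] assms L2_class_rep[OF L2_class_in_L2[OF assms]]
  by (rule L2_class_eqD)

lemma L2_inner_class:
  assumes "f \<in> L2_fun M" "g \<in> L2_fun M"
  shows "L2_inner M (L2_class M f) (L2_class M g) = inner_fun M f g"
proof -
  note r = assms[THEN L2_class_in_L2, THEN L2_rep_in_L2_fun, THEN L2_fun_measurable]
  note [measurable] = r assms[THEN L2_fun_measurable]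
  show ?thesis unfolding L2_inner_def inner_fun_def
  proof (rule integral_cong_AE)
    show "AE x in M. L2_rep (L2_class M f) x * cnj (L2_rep (L2_class M g) x) = f x * cnj (g x)"
      using L2_rep_class[OF assms(1)] L2_rep_class[OF assms(2)] by eventually_elim simp
  qed measurable
qed

lemma L2_diff_class:
  assumes "f \<in> L2_fun M" "g \<in> L2_fun M"
  shows "L2_diff M (L2_class M f) (L2_class M g) = L2_class M (\<lambda>x. f x - g x)"
  unfolding L2_diff_def
proof (rule L2_class_eqI)
  show "AE x in M. L2_rep (L2_class M f) x - L2_rep (L2_class M g) x = f x - g x"
    using L2_rep_class[OF assms(1)] L2_rep_class[OF assms(2)] by eventually_elim simp
qed (intro L2_fun_diff assms L2_rep_in_L2_fun L2_class_in_L2)+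

lemma L2_diff_in_L2: "F \<in> L2 M \<Longrightarrow> G \<in> L2 M \<Longrightarrow> L2_diff M F G \<in> L2 M"
  unfolding L2_diff_def by (rule L2_class_in_L2) (intro L2_fun_diff L2_rep_in_L2_fun)

lemma L2_add_class:
  assumes "f \<in> L2_fun M" "g \<in> L2_fun M"
  shows "L2_add M (L2_class M f) (L2_class M g) = L2_class M (\<lambda>x. f x + g x)"
  unfolding L2_add_def
proof (rule L2_class_eqI)
  show "AE x in M. L2_rep (L2_class M f) x + L2_rep (L2_class M g) x = f x + g x"
    using L2_rep_class[OF assms(1)] L2_rep_class[OF assms(2)] by eventually_elim simp
qed (intro L2_fun_add assms L2_rep_in_L2_fun L2_class_in_L2)+

lemma L2_scale_class:
  assumes "f \<in> L2_fun M"
  shows "L2_scale M c (L2_class M f) = L2_class M (\<lambda>x. c * f x)"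
  unfolding L2_scale_def
proof (rule L2_class_eqI)
  show "AE x in M. c * L2_rep (L2_class M f) x = c * f x"
    using L2_rep_class[OF assms(1)] by eventually_elim simp
qed (intro L2_fun_scale assms L2_rep_in_L2_fun L2_class_in_L2)+

lemma L2_norm_class:
  assumes "f \<in> L2_fun M"
  shows "L2_norm M (L2_class M f) = norm_fun M f"
  unfolding L2_norm_def L2_inner_class[OF assms assms] inner_fun_self by (simp add: norm_fun_nonneg)

section \<open>Orthogonal projection onto the closed span of an orthonormal family\<close>

text \<open>The Hardy spaces are the instances in which \<open>e\<close> is the family of Laurent monomials on the torus.\<close>

definition closed_span ::
  "'a measure \<Rightarrow> ('i \<Rightarrow> 'a \<Rightarrow> complex) \<Rightarrow> 'i set \<Rightarrow> ('a \<Rightarrow> complex) set set" where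
  "closed_span M e A = {F \<in> L2 M. \<exists>a. (\<lambda>i. (norm (a i))\<^sup>2) summable_on A \<and>
     ((\<lambda>S. L2_norm M (L2_diff M F (L2_class M (\<lambda>x. \<Sum>i\<in>S. a i * e i x))))
       \<longlongrightarrow> 0) (finite_subsets_at_top A)}"

lemma closed_span_subset_L2: "closed_span M e A \<subseteq> L2 M"
  by (auto simp: closed_span_def)

text \<open>This is what makes the definite description in \<open>orth_proj\<close> meaningful at \<open>F\<close>.\<close>

definition unique_projection ::
  "'a measure \<Rightarrow> ('a \<Rightarrow> complex) set set \<Rightarrow> ('a \<Rightarrow> complex) set \<Rightarrow> bool" where
  "unique_projection M H F \<longleftrightarrow> (\<exists>!G. G \<in> H \<and> (\<forall>K\<in>H. L2_inner M (L2_diff M F G) K = 0))"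

lemma orth_proj_in:
  assumes "unique_projection M H F"
  shows "orth_proj M H F \<in> H"
    and "K \<in> H \<Longrightarrow> L2_inner M (L2_diff M F (orth_proj M H F)) K = 0"
proof -
  note P = theI'[OF assms[unfolded unique_projection_def], folded orth_proj_def]
  show "orth_proj M H F \<in> H" using P by (rule conjunct1)
  show "L2_inner M (L2_diff M F (orth_proj M H F)) K = 0" if "K \<in> H"
    using P[THEN conjunct2] that by (rule bspec)
qed

lemma orth_proj_unique:
  assumes "unique_projection M H F" "G \<in> H" "\<And>K. K \<in> H \<Longrightarrow> L2_inner M (L2_diff M F G) K = 0"
  shows "orth_proj M H F = G"
  unfolding orth_proj_def
  by (rule the1_equality[OF assms(1)[unfolded unique_projection_def]]) (simp add: assms(2,3))

context orthonormal_family
begin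

lemma class_in_closed_span_iff:
  assumes "f \<in> L2_fun M"
  shows "L2_class M f \<in> closed_span M e A \<longleftrightarrow>
    (\<exists>a. (\<lambda>i. (norm (a i))\<^sup>2) summable_on A \<and> expansion f a)"
proof -
  have "((\<lambda>S. L2_norm M (L2_diff M (L2_class M f) (L2_class M (\<lambda>x. \<Sum>i\<in>S. a i * e i x))))
          \<longlongrightarrow> 0) (finite_subsets_at_top A) \<longleftrightarrow> expansion f a" for a
    unfolding expansion_def
  proof (intro tendsto_cong eventually_finite_subsets_at_top_weakI)
    fix S assume "S \<subseteq> A"
    then show "L2_norm M (L2_diff M (L2_class M f) (L2_class M (\<lambda>x. \<Sum>i\<in>S. a i * e i x)))
        = norm_fun M (\<lambda>x. f x - (\<Sum>i\<in>S. a i * e i x))"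
      using assms by (simp add: L2_diff_class L2_norm_class L2_fun_diff combination_in_L2)
  qed
  then show ?thesis using L2_class_in_L2[OF assms] by (simp add: closed_span_def)
qed

text \<open>The projection of \<open>f\<close> is the function whose coefficients are the \<open>\<langle>f, e\<^sub>i\<rangle>\<close>: they are square
summable by Bessel's inequality, and the remainder is orthogonal to every \<open>e\<^sub>i\<close>, hence to
every limit of finite combinations. Any competitor has the same coefficients, because the \<open>e\<^sub>i\<close> lie
in the span themselves; its difference from the projection is then orthogonal to both, hence to
itself.\<close>

lemma unique_projection_closed_span:
  assumes "F \<in> L2 M"
  shows "unique_projection M (closed_span M e A) F"
proof -
  let ?H = "closed_span M e A"
  let ?ortho = "\<lambda>G. G \<in> ?H \<and> (\<forall>K\<in>?H. L2_inner M (L2_diff M F G) K = 0)"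
  obtain f where f: "f \<in> L2_fun M" "F = L2_class M f" using assms by (rule L2_cases)
  obtain p where p: "p \<in> L2_fun M" "expansion p (\<lambda>i. inner_fun M f (e i))"
    using square_summable_expansion[OF summable_coefficients[OF f(1)]] by blast
  have ortho_iff: "?ortho (L2_class M g) \<longleftrightarrow>
      L2_class M g \<in> ?H \<and> (\<forall>k\<in>L2_fun M. L2_class M k \<in> ?H \<longrightarrow> inner_fun M (\<lambda>x. f x - g x) k = 0)"
    if g: "g \<in> L2_fun M" for g
  proof -
    have "L2_inner M (L2_diff M F (L2_class M g)) (L2_class M k) = inner_fun M (\<lambda>x. f x - g x) k"
      if "k \<in> L2_fun M" for k
      using that f g by (simp add: L2_diff_class L2_inner_class L2_fun_diff)
    then show ?thesis
      using closed_span_subset_L2[of M e A] by (auto elim!: L2_cases)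
  qed
  have e_in: "L2_class M (e i) \<in> ?H" if "i \<in> A" for i
  proof -
    have "(\<lambda>j. (norm (if j = i then 1 else 0 :: complex))\<^sup>2) summable_on A"
      by (rule finite_nonzero_values_imp_summable_on)
         (auto intro: finite_subset[of _ "{i}"] split: if_splits)
    then show ?thesis
      unfolding class_in_closed_span_iff[OF in_L2[OF that]] using expansion_e[OF that]
      by (intro exI[of _ "\<lambda>j. if j = i then 1 else 0"] conjI)
  qed
  have "?ortho (L2_class M p)"
    unfolding ortho_iff[OF p(1)]
  proof (intro conjI ballI impI)
    show "L2_class M p \<in> ?H"
      unfolding class_in_closed_span_iff[OF p(1)]
      by (intro exI[of _ "\<lambda>i. inner_fun M f (e i)"] conjI p(2) summable_coefficients f(1))
    fix k assume k: "k \<in> L2_fun M" "L2_class M k \<in> ?H"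
    then obtain a where "expansion k a" using class_in_closed_span_iff[OF k(1)] by blast
    then show "inner_fun M (\<lambda>x. f x - p x) k = 0"
    proof (rule expansion_orthogonal)
      fix i assume "i \<in> A"
      then show "inner_fun M (\<lambda>x. f x - p x) (e i) = 0"
        using expansion_coefficient[OF p(2,1)] by (simp add: inner_fun_diff_left f p in_L2)
    qed (intro k L2_fun_diff f p)+
  qed
  moreover have "G = L2_class M p" if G: "?ortho G" for G
  proof -
    have "G \<in> L2 M" using G closed_span_subset_L2 by blast
    then obtain g where g: "g \<in> L2_fun M" "G = L2_class M g" by (rule L2_cases)
    have og: "L2_class M g \<in> ?H"
      "\<And>k. k \<in> L2_fun M \<Longrightarrow> L2_class M k \<in> ?H \<Longrightarrow> inner_fun M (\<lambda>x. f x - g x) k = 0"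
      using G ortho_iff[OF g(1)] unfolding g(2) by blast+
    have d: "(\<lambda>x. g x - p x) \<in> L2_fun M" by (intro L2_fun_diff g p)
    have de: "inner_fun M (\<lambda>x. g x - p x) (e i) = 0" if "i \<in> A" for i
    proof -
      have "inner_fun M f (e i) - inner_fun M g (e i) = 0"
        using og(2)[OF in_L2[OF that] e_in[OF that]] by (simp add: inner_fun_diff_left f g in_L2 that)
      then show ?thesis
        using expansion_coefficient[OF p(2,1) that] by (simp add: inner_fun_diff_left p g in_L2 that)
    qed
    obtain a where "expansion g a" using og(1) class_in_closed_span_iff[OF g(1)] by blast
    then have "inner_fun M (\<lambda>x. g x - p x) g = 0" using g(1) d de by (rule expansion_orthogonal)
    moreover have "inner_fun M (\<lambda>x. g x - p x) p = 0" using p(2,1) d de by (rule expansion_orthogonal)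
    ultimately have "inner_fun M (\<lambda>x. g x - p x) (\<lambda>x. g x - p x) = 0"
      using inner_fun_diff_right[OF g(1) p(1) d] by simp
    then have "norm_fun M (\<lambda>x. g x - p x) = 0" by (simp add: inner_fun_self)
    from norm_fun_eq_0_AE[OF d this] show ?thesis
      unfolding g(2) by (intro L2_class_eqI g p) simp
  qed
  ultimately show ?thesis unfolding unique_projection_def by blast
qed

end

section \<open>Unitary weighted composition operators\<close>

text \<open>Multiplication by a unimodular weight after an invertible measure-preserving change of variables.
The inverse \<open>S\<close> is only required to invert \<open>T\<close> on the underlying space, because the maps between
tori are defined on all functions and are not bijective there.\<close>

locale weighted_composition =
  fixes M :: "'a measure" and T S :: "'a \<Rightarrow> 'a" and w :: "'a \<Rightarrow> complex"
  assumes T_measurable [measurable]: "T \<in> measurable M M"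
    and S_measurable [measurable]: "S \<in> measurable M M"
    and w_measurable [measurable]: "w \<in> borel_measurable M"
    and preserving: "distr M M T = M"
    and S_T: "x \<in> space M \<Longrightarrow> S (T x) = x"
    and T_S: "x \<in> space M \<Longrightarrow> T (S x) = x"
    and norm_w: "x \<in> space M \<Longrightarrow> norm (w x) = 1"
begin

text \<open>The operator on functions and the one on classes are kept apart: the first one is computed
pointwise, the second one acts through a chosen representative.\<close>

definition wcomp :: "('a \<Rightarrow> complex) \<Rightarrow> 'a \<Rightarrow> complex" where
  "wcomp f x = w x * f (T x)"

definition class_wcomp :: "('a \<Rightarrow> complex) set \<Rightarrow> ('a \<Rightarrow> complex) set" where
  "class_wcomp F = L2_class M (\<lambda>x. w x * L2_rep F (T x))"

lemma inverse_preserving: "distr M M S = M"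
proof -
  have "distr M M S = distr (distr M M T) M S" by (simp add: preserving)
  also have "\<dots> = distr M M (S \<circ> T)" by (rule distr_distr) measurable
  also have "\<dots> = distr M M (\<lambda>x. x)" by (rule distr_cong) (auto simp: S_T)
  finally show ?thesis by simp
qed

text \<open>The inverse operator \<open>g \<mapsto> (cnj w \<cdot> g) \<circ> S\<close> is of the same kind, so everything proved for the
operator holds for its inverse as well.\<close>

lemma inverse: "weighted_composition M S T (\<lambda>x. cnj (w (S x)))"
proof
  show "(\<lambda>x. cnj (w (S x))) \<in> borel_measurable M" by measurable
  show "norm (cnj (w (S x))) = 1" if "x \<in> space M" for x
    using norm_w measurable_space[OF S_measurable that] by simp
qed (auto simp: S_T T_S inverse_preserving)

lemma AE_T:
  assumes "AE x in M. P x"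
  shows "AE x in M. P (T x)"
proof (rule AE_distrD[OF T_measurable])
  show "AE x in distr M M T. P x" unfolding preserving by (rule assms)
qed

lemma wcomp_in_L2:
  assumes "f \<in> L2_fun M"
  shows "wcomp f \<in> L2_fun M"
proof (rule L2_funI)
  note [measurable] = L2_fun_measurable[OF assms]
  show "wcomp f \<in> borel_measurable M" unfolding wcomp_def[abs_def] by measurable
  have "integrable (distr M M T) (\<lambda>x. (norm (f x))\<^sup>2)"
    using L2_fun_integrable[OF assms] by (simp add: preserving)
  then have "integrable M (\<lambda>x. (norm (f (T x)))\<^sup>2)"
    by (subst (asm) integrable_distr_eq) measurable
  then show "integrable M (\<lambda>x. (norm (wcomp f x))\<^sup>2)"
    by (rule Bochner_Integration.integrable_cong[THEN iffD1, rotated -1])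
       (auto simp: wcomp_def norm_mult norm_w)
qed

lemma inner_fun_wcomp:
  assumes "f \<in> L2_fun M" "g \<in> L2_fun M"
  shows "inner_fun M (wcomp f) (wcomp g) = inner_fun M f g"
proof -
  note [measurable] = assms[THEN L2_fun_measurable]
  have "inner_fun M f g = (LINT x|distr M M T. f x * cnj (g x))" by (simp add: inner_fun_def preserving)
  also have "\<dots> = (LINT x|M. f (T x) * cnj (g (T x)))"
    by (rule integral_distr) measurable
  also have "\<dots> = inner_fun M (wcomp f) (wcomp g)"
    unfolding inner_fun_def
  proof (rule Bochner_Integration.integral_cong)
    fix x assume "x \<in> space M"
    then have "w x * cnj (w x) = 1" using norm_w[of x] by (simp flip: complex_norm_square)
    then show "f (T x) * cnj (g (T x)) = wcomp f x * cnj (wcomp g x)"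
      unfolding wcomp_def by (simp add: ac_simps)
  qed simp
  finally show ?thesis by simp
qed

lemma class_wcomp_of_class:
  assumes "f \<in> L2_fun M"
  shows "class_wcomp (L2_class M f) = L2_class M (wcomp f)"
  unfolding class_wcomp_def
proof (rule L2_class_eqI)
  show "(\<lambda>x. w x * L2_rep (L2_class M f) (T x)) \<in> L2_fun M"
    using wcomp_in_L2[OF L2_rep_in_L2_fun[OF L2_class_in_L2[OF assms]]] unfolding wcomp_def[abs_def] .
  show "AE x in M. w x * L2_rep (L2_class M f) (T x) = wcomp f x"
    using AE_T[OF L2_rep_class[OF assms]] by eventually_elim (simp add: wcomp_def)
qed (rule wcomp_in_L2[OF assms])

lemma class_wcomp_in_L2:
  assumes "F \<in> L2 M"
  shows "class_wcomp F \<in> L2 M"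
proof -
  obtain f where "f \<in> L2_fun M" "F = L2_class M f" using assms by (rule L2_cases)
  then show ?thesis by (simp add: class_wcomp_of_class wcomp_in_L2 L2_class_in_L2)
qed

lemma class_wcomp_add:
  assumes "F \<in> L2 M" "G \<in> L2 M"
  shows "class_wcomp (L2_add M F G) = L2_add M (class_wcomp F) (class_wcomp G)"
proof -
  obtain f where f: "f \<in> L2_fun M" "F = L2_class M f" using assms(1) by (rule L2_cases)
  obtain g where g: "g \<in> L2_fun M" "G = L2_class M g" using assms(2) by (rule L2_cases)
  have "wcomp (\<lambda>x. f x + g x) = (\<lambda>x. wcomp f x + wcomp g x)" by (simp add: wcomp_def fun_eq_iff distrib_left)
  then show ?thesis by (simp add: f g class_wcomp_of_class L2_add_class wcomp_in_L2 L2_fun_add)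
qed

lemma class_wcomp_diff:
  assumes "F \<in> L2 M" "G \<in> L2 M"
  shows "class_wcomp (L2_diff M F G) = L2_diff M (class_wcomp F) (class_wcomp G)"
proof -
  obtain f where f: "f \<in> L2_fun M" "F = L2_class M f" using assms(1) by (rule L2_cases)
  obtain g where g: "g \<in> L2_fun M" "G = L2_class M g" using assms(2) by (rule L2_cases)
  have "wcomp (\<lambda>x. f x - g x) = (\<lambda>x. wcomp f x - wcomp g x)"
    by (simp add: wcomp_def fun_eq_iff right_diff_distrib)
  then show ?thesis by (simp add: f g class_wcomp_of_class L2_diff_class wcomp_in_L2 L2_fun_diff)
qed

lemma class_wcomp_scale:
  assumes "F \<in> L2 M"
  shows "class_wcomp (L2_scale M c F) = L2_scale M c (class_wcomp F)"
proof -
  obtain f where f: "f \<in> L2_fun M" "F = L2_class M f" using assms(1) by (rule L2_cases)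
  have "wcomp (\<lambda>x. c * f x) = (\<lambda>x. c * wcomp f x)" by (simp add: wcomp_def fun_eq_iff)
  then show ?thesis by (simp add: f class_wcomp_of_class L2_scale_class wcomp_in_L2 L2_fun_scale)
qed

lemma class_wcomp_inner:
  assumes "F \<in> L2 M" "G \<in> L2 M"
  shows "L2_inner M (class_wcomp F) (class_wcomp G) = L2_inner M F G"
proof -
  obtain f where f: "f \<in> L2_fun M" "F = L2_class M f" using assms(1) by (rule L2_cases)
  obtain g where g: "g \<in> L2_fun M" "G = L2_class M g" using assms(2) by (rule L2_cases)
  show ?thesis by (simp add: f g class_wcomp_of_class L2_inner_class wcomp_in_L2 inner_fun_wcomp)
qed

lemma class_wcomp_norm: "F \<in> L2 M \<Longrightarrow> L2_norm M (class_wcomp F) = L2_norm M F"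
  by (simp add: L2_norm_def class_wcomp_inner)

lemma bij_class_wcomp: "bij_betw class_wcomp (L2 M) (L2 M)"
proof -
  interpret inv: weighted_composition M S T "\<lambda>x. cnj (w (S x))" by (rule inverse)
  have unit: "cnj (w x) * w x = 1" if "x \<in> space M" for x
    using norm_w[OF that] by (simp flip: complex_norm_square add: mult.commute[of "cnj _"])
  have inv1: "inv.class_wcomp (class_wcomp F) = F" if "F \<in> L2 M" for F
  proof -
    from that obtain f where f: "f \<in> L2_fun M" "F = L2_class M f" by (rule L2_cases)
    have "L2_class M (inv.wcomp (wcomp f)) = L2_class M f"
    proof (intro L2_class_eqI inv.wcomp_in_L2 wcomp_in_L2 f AE_I2)
      fix x assume x: "x \<in> space M"
      have "inv.wcomp (wcomp f) x = (cnj (w (S x)) * w (S x)) * f (T (S x))"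
        by (simp add: wcomp_def inv.wcomp_def)
      then show "inv.wcomp (wcomp f) x = f x"
        using x unit[OF measurable_space[OF S_measurable x]] by (simp add: T_S)
    qed
    then show ?thesis by (simp add: f class_wcomp_of_class inv.class_wcomp_of_class wcomp_in_L2)
  qed
  have inv2: "class_wcomp (inv.class_wcomp F) = F" if "F \<in> L2 M" for F
  proof -
    from that obtain f where f: "f \<in> L2_fun M" "F = L2_class M f" by (rule L2_cases)
    have "L2_class M (wcomp (inv.wcomp f)) = L2_class M f"
    proof (intro L2_class_eqI inv.wcomp_in_L2 wcomp_in_L2 f AE_I2)
      fix x assume x: "x \<in> space M"
      have "wcomp (inv.wcomp f) x = (cnj (w (S (T x))) * w x) * f (S (T x))"
        by (simp add: wcomp_def inv.wcomp_def)
      then show "wcomp (inv.wcomp f) x = f x" using x unit[OF x] by (simp add: S_T)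
    qed
    then show ?thesis by (simp add: f class_wcomp_of_class inv.class_wcomp_of_class inv.wcomp_in_L2)
  qed
  show ?thesis
    by (rule bij_betwI[where g = inv.class_wcomp])
       (auto simp: inv1 inv2 class_wcomp_in_L2 inv.class_wcomp_in_L2)
qed

lemma unitary_class_wcomp:
  assumes "H \<subseteq> L2 M"
  shows "unitary_between M H (class_wcomp ` H) class_wcomp"
  unfolding unitary_between_def
proof (intro conjI ballI allI)
  show "bij_betw class_wcomp H (class_wcomp ` H)"
    using bij_class_wcomp assms by (auto simp: bij_betw_def intro: inj_on_subset)
qed (simp_all add: class_wcomp_add class_wcomp_scale class_wcomp_inner subsetD[OF assms])

text \<open>If the operator sends each \<open>e\<^sub>i\<close> to \<open>e'\<^bsub>\<sigma> i\<^esub>\<close>, it sends partial sums to partial sums with relabelled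
coefficients. Being isometric it preserves the distances to them, and the relabelling is an
isomorphism of the nets of finite sets. Being onto \<open>L\<^sup>2\<close> it reaches the whole target.\<close>

lemma class_wcomp_closed_span:
  assumes inj: "inj_on \<sigma> A"
    and e: "\<And>i. i \<in> A \<Longrightarrow> e i \<in> L2_fun M"
    and wcomp_e: "\<And>i x. i \<in> A \<Longrightarrow> x \<in> space M \<Longrightarrow> wcomp (e i) x = e' (\<sigma> i) x"
  shows "class_wcomp ` closed_span M e A = closed_span M e' (\<sigma> ` A)"
proof -
  let ?c = "\<lambda>a S. L2_class M (\<lambda>x. \<Sum>i\<in>S. a i * e i x)"
  let ?c' = "\<lambda>b S. L2_class M (\<lambda>x. \<Sum>i\<in>S. b i * e' i x)"
  have W_c: "?c' b (\<sigma> ` S) = class_wcomp (?c (b \<circ> \<sigma>) S)" if S: "S \<subseteq> A" for b S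
  proof -
    have s: "(\<lambda>x. \<Sum>i\<in>S. (b \<circ> \<sigma>) i * e i x) \<in> L2_fun M"
      using S e by (intro L2_fun_combination) blast
    have eq: "wcomp (\<lambda>x. \<Sum>i\<in>S. (b \<circ> \<sigma>) i * e i x) x = (\<Sum>i\<in>\<sigma> ` S. b i * e' i x)"
      if x: "x \<in> space M" for x
    proof -
      have "wcomp (\<lambda>x. \<Sum>i\<in>S. (b \<circ> \<sigma>) i * e i x) x = (\<Sum>i\<in>S. b (\<sigma> i) * wcomp (e i) x)"
        by (simp add: wcomp_def sum_distrib_left ac_simps)
      also have "\<dots> = (\<Sum>i\<in>S. b (\<sigma> i) * e' (\<sigma> i) x)"
        using S x wcomp_e by (intro sum.cong) auto
      also have "\<dots> = (\<Sum>i\<in>\<sigma> ` S. b i * e' i x)"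
        using inj_on_subset[OF inj S] by (simp add: sum.reindex)
      finally show ?thesis .
    qed
    have s': "(\<lambda>x. \<Sum>i\<in>\<sigma> ` S. b i * e' i x) \<in> L2_fun M"
    proof (rule L2_fun_bound[OF wcomp_in_L2[OF s], of _ 1])
      show "(\<lambda>x. \<Sum>i\<in>\<sigma> ` S. b i * e' i x) \<in> borel_measurable M"
        using L2_fun_measurable[OF wcomp_in_L2[OF s]] eq by (subst measurable_cong[OF eq[symmetric]])
      show "AE x in M. norm (\<Sum>i\<in>\<sigma> ` S. b i * e' i x)
          \<le> 1 * norm (wcomp (\<lambda>x. \<Sum>i\<in>S. (b \<circ> \<sigma>) i * e i x) x)"
        by (intro AE_I2) (simp only: eq mult_1 order_refl)
    qed
    have "L2_class M (wcomp (\<lambda>x. \<Sum>i\<in>S. (b \<circ> \<sigma>) i * e i x)) = ?c' b (\<sigma> ` S)"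
      by (intro L2_class_eqI wcomp_in_L2[OF s] s' AE_I2 eq)
    then show ?thesis using class_wcomp_of_class[OF s] by simp
  qed
  have norm_eq: "L2_norm M (L2_diff M (class_wcomp F) (?c' b (\<sigma> ` S)))
      = L2_norm M (L2_diff M F (?c (b \<circ> \<sigma>) S))"
    if F: "F \<in> L2 M" and S: "S \<subseteq> A" for F b S
  proof -
    have c: "?c (b \<circ> \<sigma>) S \<in> L2 M"
      using S e by (intro L2_class_in_L2 L2_fun_combination) blast
    have "L2_diff M F (?c (b \<circ> \<sigma>) S) \<in> L2 M" by (rule L2_diff_in_L2[OF F c])
    then show ?thesis by (simp only: W_c[OF S] class_wcomp_diff[OF F c, symmetric] class_wcomp_norm)
  qed
  have lim: "((\<lambda>S. L2_norm M (L2_diff M (class_wcomp F) (?c' b S))) \<longlongrightarrow> 0)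
        (finite_subsets_at_top (\<sigma> ` A))
      \<longleftrightarrow> ((\<lambda>S. L2_norm M (L2_diff M F (?c (b \<circ> \<sigma>) S))) \<longlongrightarrow> 0) (finite_subsets_at_top A)"
    if F: "F \<in> L2 M" for F b
    unfolding filtermap_image_finite_subsets_at_top[OF inj, symmetric] filterlim_filtermap
    by (intro tendsto_cong eventually_finite_subsets_at_top_weakI norm_eq F)
  have iff: "class_wcomp F \<in> closed_span M e' (\<sigma> ` A) \<longleftrightarrow> F \<in> closed_span M e A" if F: "F \<in> L2 M" for F
  proof
    assume "class_wcomp F \<in> closed_span M e' (\<sigma> ` A)"
    then obtain b where "(\<lambda>i. (norm (b i))\<^sup>2) summable_on (\<sigma> ` A)"
      "((\<lambda>S. L2_norm M (L2_diff M (class_wcomp F) (?c' b S))) \<longlongrightarrow> 0) (finite_subsets_at_top (\<sigma> ` A))"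
      by (auto simp: closed_span_def)
    then show "F \<in> closed_span M e A"
      using F lim[OF F, of b] summable_on_reindex[OF inj, of "\<lambda>i. (norm (b i))\<^sup>2"]
      by (auto simp: closed_span_def o_def intro!: exI[of _ "b \<circ> \<sigma>"])
  next
    assume "F \<in> closed_span M e A"
    then obtain a where a: "(\<lambda>i. (norm (a i))\<^sup>2) summable_on A"
      "((\<lambda>S. L2_norm M (L2_diff M F (?c a S))) \<longlongrightarrow> 0) (finite_subsets_at_top A)"
      by (auto simp: closed_span_def)
    \<comment> \<open>Coefficients in the target are indexed by \<open>\<sigma> ` A\<close>, so those of \<open>F\<close> are pulled back along \<open>\<sigma>\<close>.\<close>
    define b where "b = a \<circ> inv_into A \<sigma>"
    have b: "(b \<circ> \<sigma>) i = a i" if "i \<in> A" for i using that inj by (simp add: b_def)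
    have "(\<lambda>i. (norm ((b \<circ> \<sigma>) i))\<^sup>2) summable_on A"
      using a(1) by (subst summable_on_cong[of _ _ "\<lambda>i. (norm (a i))\<^sup>2"]) (simp_all only: b)
    then have "(\<lambda>i. (norm (b i))\<^sup>2) summable_on (\<sigma> ` A)"
      by (simp add: summable_on_reindex[OF inj] o_def)
    moreover have "((\<lambda>S. L2_norm M (L2_diff M F (?c (b \<circ> \<sigma>) S))) \<longlongrightarrow> 0) (finite_subsets_at_top A)"
    proof (rule Lim_transform_eventually[OF a(2)], rule eventually_finite_subsets_at_top_weakI)
      fix S assume "S \<subseteq> A"
      then have "(\<Sum>i\<in>S. a i * e i x) = (\<Sum>i\<in>S. (b \<circ> \<sigma>) i * e i x)" for x
        by (intro sum.cong refl) (simp only: b subsetD)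
      then show "L2_norm M (L2_diff M F (?c a S)) = L2_norm M (L2_diff M F (?c (b \<circ> \<sigma>) S))"
        by simp
    qed
    ultimately show "class_wcomp F \<in> closed_span M e' (\<sigma> ` A)"
      using lim[OF F, of b] class_wcomp_in_L2[OF F] by (auto simp: closed_span_def)
  qed
  show ?thesis
  proof (intro equalityI subsetI)
    fix G assume G: "G \<in> closed_span M e' (\<sigma> ` A)"
    then have "G \<in> class_wcomp ` L2 M"
      using bij_betw_imp_surj_on[OF bij_class_wcomp] closed_span_subset_L2 by blast
    then obtain F where F: "F \<in> L2 M" "G = class_wcomp F" by blast
    then have "F \<in> closed_span M e A" using G iff[OF F(1)] by simp
    then show "G \<in> class_wcomp ` closed_span M e A" unfolding F(2) by (rule imageI)
  next
    fix G assume "G \<in> class_wcomp ` closed_span M e A"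
    then obtain F where F: "F \<in> closed_span M e A" "G = class_wcomp F" by blast
    then show "G \<in> closed_span M e' (\<sigma> ` A)"
      using iff subsetD[OF closed_span_subset_L2 F(1)] by simp
  qed
qed

text \<open>An isometry preserves the orthogonality relations that characterize the projection.\<close>

lemma orth_proj_class_wcomp:
  assumes H: "H \<subseteq> L2 M" and F: "F \<in> L2 M"
    and proj: "unique_projection M H F" "unique_projection M (class_wcomp ` H) (class_wcomp F)"
  shows "orth_proj M (class_wcomp ` H) (class_wcomp F) = class_wcomp (orth_proj M H F)"
proof (rule orth_proj_unique[OF proj(2)])
  let ?P = "orth_proj M H F"
  show "class_wcomp ?P \<in> class_wcomp ` H" using orth_proj_in(1)[OF proj(1)] by blast
  fix K' assume "K' \<in> class_wcomp ` H"
  then obtain K where K: "K \<in> H" "K' = class_wcomp K" by blast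
  have P: "?P \<in> L2 M" using orth_proj_in(1)[OF proj(1)] H by blast
  have "L2_diff M F ?P \<in> L2 M"
    by (rule L2_diff_in_L2[OF F P])
  then have "L2_inner M (class_wcomp (L2_diff M F ?P)) (class_wcomp K) = L2_inner M (L2_diff M F ?P) K"
    using K(1) H by (intro class_wcomp_inner) auto
  also have "\<dots> = 0" using orth_proj_in(2)[OF proj(1) K(1)] .
  finally show "L2_inner M (L2_diff M (class_wcomp F) (class_wcomp ?P)) K' = 0"
    by (simp add: K(2) class_wcomp_diff F P)
qed

lemma Linfty_T:
  assumes "\<phi> \<in> Linfty_fun M"
  shows "\<phi> \<circ> T \<in> Linfty_fun M"
proof -
  obtain C where C: "\<phi> \<in> borel_measurable M" "AE x in M. norm (\<phi> x) \<le> C"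
    using assms by (auto simp: Linfty_fun_def)
  then have "AE x in M. norm ((\<phi> \<circ> T) x) \<le> C" using AE_T by simp
  moreover have "\<phi> \<circ> T \<in> borel_measurable M" using C(1) by (rule measurable_comp[OF T_measurable])
  ultimately show ?thesis by (auto simp: Linfty_fun_def)
qed

text \<open>Multiplying by \<open>\<phi>\<close> and then applying the operator is the same as applying the operator and then
multiplying by \<open>\<phi> \<circ> T\<close>; the projections correspond to each other as well.\<close>

lemma toeplitz_class_wcomp:
  assumes H: "H \<subseteq> L2 M" and \<phi>: "\<phi> \<in> Linfty_fun M" and F: "F \<in> L2 M"
    and proj: "\<And>G. G \<in> L2 M \<Longrightarrow> unique_projection M H G"
      "\<And>G. G \<in> L2 M \<Longrightarrow> unique_projection M (class_wcomp ` H) G"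
  shows "toeplitz M (class_wcomp ` H) (\<phi> \<circ> T) (class_wcomp F) = class_wcomp (toeplitz M H \<phi> F)"
proof -
  let ?g = "\<lambda>x. \<phi> x * L2_rep F x"
  have g: "?g \<in> L2_fun M" by (intro bounded_mult_in_L2 \<phi> L2_rep_in_L2_fun F)
  have Uf: "wcomp (L2_rep F) \<in> L2_fun M" by (intro wcomp_in_L2 L2_rep_in_L2_fun F)
  have WF: "class_wcomp F = L2_class M (wcomp (L2_rep F))" by (simp add: class_wcomp_def wcomp_def[abs_def])
  have "L2_class M (\<lambda>x. (\<phi> \<circ> T) x * L2_rep (class_wcomp F) x) = L2_class M (wcomp ?g)"
  proof (rule L2_class_eqI)
    show "(\<lambda>x. (\<phi> \<circ> T) x * L2_rep (class_wcomp F) x) \<in> L2_fun M"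
      by (intro bounded_mult_in_L2 Linfty_T \<phi> L2_rep_in_L2_fun class_wcomp_in_L2 F)
    show "AE x in M. (\<phi> \<circ> T) x * L2_rep (class_wcomp F) x = wcomp ?g x"
      using L2_rep_class[OF Uf] by eventually_elim (simp add: WF wcomp_def)
  qed (rule wcomp_in_L2[OF g])
  then have "L2_class M (\<lambda>x. (\<phi> \<circ> T) x * L2_rep (class_wcomp F) x) = class_wcomp (L2_class M ?g)"
    by (simp add: class_wcomp_of_class[OF g])
  then show ?thesis
    unfolding toeplitz_def
    by (simp only:) (intro orth_proj_class_wcomp H proj class_wcomp_in_L2 L2_class_in_L2 g)
qed

end

section \<open>The circle\<close>

text \<open>The part of the translated period that sticks out beyond \<open>p\<close> is moved back by one period.\<close>

lemma nn_integral_periodic_shift: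
  fixes g :: "real \<Rightarrow> ennreal"
  assumes [measurable]: "g \<in> borel_measurable borel"
    and periodic: "\<And>t. g (t + p) = g t" and \<theta>: "0 \<le> \<theta>" "\<theta> \<le> p"
  shows "(\<integral>\<^sup>+t. g (t + \<theta>) * indicator {0..<p} t \<partial>lborel) = (\<integral>\<^sup>+t. g t * indicator {0..<p} t \<partial>lborel)"
proof -
  have shift: "(\<integral>\<^sup>+t. f t \<partial>lborel) = (\<integral>\<^sup>+t. f (t + c) \<partial>lborel)"
    if "f \<in> borel_measurable borel" for f :: "real \<Rightarrow> ennreal" and c :: real
    using nn_integral_real_affine[OF that, of 1 c] by (simp add: add.commute)
  have "(\<integral>\<^sup>+t. g (t + \<theta>) * indicator {0..<p} t \<partial>lborel)
      = (\<integral>\<^sup>+t. g (t + \<theta>) * indicator {\<theta>..<p + \<theta>} (t + \<theta>) \<partial>lborel)"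
    by (intro nn_integral_cong) (auto simp: indicator_def)
  also have "\<dots> = (\<integral>\<^sup>+t. g t * indicator {\<theta>..<p + \<theta>} t \<partial>lborel)"
    by (rule shift[symmetric]) measurable
  also have "\<dots> = (\<integral>\<^sup>+t. g t * indicator {\<theta>..<p} t + g t * indicator {p..<p + \<theta>} t \<partial>lborel)"
    using \<theta> by (intro nn_integral_cong) (auto simp: indicator_def)
  also have "\<dots> = (\<integral>\<^sup>+t. g t * indicator {\<theta>..<p} t \<partial>lborel) + (\<integral>\<^sup>+t. g t * indicator {p..<p + \<theta>} t \<partial>lborel)"
    by (rule nn_integral_add) measurable
  also have "(\<integral>\<^sup>+t. g t * indicator {p..<p + \<theta>} t \<partial>lborel)
      = (\<integral>\<^sup>+t. g (t + p) * indicator {p..<p + \<theta>} (t + p) \<partial>lborel)"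
    by (rule shift) measurable
  also have "\<dots> = (\<integral>\<^sup>+t. g t * indicator {0..<\<theta>} t \<partial>lborel)"
    by (intro nn_integral_cong) (auto simp: indicator_def periodic)
  also have "(\<integral>\<^sup>+t. g t * indicator {\<theta>..<p} t \<partial>lborel) + (\<integral>\<^sup>+t. g t * indicator {0..<\<theta>} t \<partial>lborel)
      = (\<integral>\<^sup>+t. g t * indicator {\<theta>..<p} t + g t * indicator {0..<\<theta>} t \<partial>lborel)"
    by (rule nn_integral_add[symmetric]) measurable
  also have "\<dots> = (\<integral>\<^sup>+t. g t * indicator {0..<p} t \<partial>lborel)"
    using \<theta> by (intro nn_integral_cong) (auto simp: indicator_def)
  finally show ?thesis .
qed

lemma space_circle: "space circle_measure = sphere 0 1"
  by (simp add: circle_measure_def space_restrict_space)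

lemma sets_circle [measurable_cong]: "sets circle_measure = sets (restrict_space borel (sphere 0 1))"
  by (simp add: circle_measure_def)

text \<open>The circle carries the trace of the Borel sets of the plane, so measurability of maps into or out
of it can be checked in the plane.\<close>

lemma measurable_into_circle:
  assumes "f \<in> borel_measurable N" "\<And>x. x \<in> space N \<Longrightarrow> norm (f x) = 1"
  shows "f \<in> measurable N circle_measure"
proof -
  have "f \<in> measurable N (restrict_space borel (sphere 0 1))"
    using assms by (intro measurable_restrict_space2) (auto simp: dist_norm)
  then show ?thesis by (simp cong: measurable_cong_sets add: sets_circle)
qed

lemma measurable_from_circle:
  assumes "f \<in> measurable N circle_measure"
  shows "f \<in> borel_measurable N"
proof -
  have "f \<in> measurable N (restrict_space borel (sphere 0 1))"
    using assms by (simp cong: measurable_cong_sets add: sets_circle)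
  then show ?thesis by (simp add: measurable_restrict_space2_iff)
qed

lemma measurable_cis: "cis \<in> borel_measurable borel"
  by (intro borel_measurable_continuous_onI continuous_intros)

lemma cis_measurable_circle: "cis \<in> measurable lborel circle_measure"
  by (rule measurable_into_circle) (auto simp: measurable_cis)

lemma nn_integral_circle:
  assumes f: "f \<in> borel_measurable circle_measure"
  shows "(\<integral>\<^sup>+z. f z \<partial>circle_measure)
    = (\<integral>\<^sup>+t. f (cis t) * indicator {0..<2 * pi} t \<partial>lborel) / ennreal (2 * pi)"
proof -
  have cis: "cis \<in> measurable (uniform_measure lborel {0..<2 * pi}) (restrict_space borel (sphere 0 1))"
    using measurable_cis by (intro measurable_restrict_space2) (simp_all cong: measurable_cong_sets)
  have f': "f \<in> borel_measurable (restrict_space borel (sphere 0 1))"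
    using f by (simp cong: measurable_cong_sets add: sets_circle)
  have [measurable]: "(\<lambda>t. f (cis t)) \<in> borel_measurable lborel"
    using measurable_compose[OF cis_measurable_circle f] .
  have "(\<integral>\<^sup>+z. f z \<partial>circle_measure) = (\<integral>\<^sup>+t. f (cis t) \<partial>uniform_measure lborel {0..<2 * pi})"
    unfolding circle_measure_def by (subst nn_integral_distr[OF cis]) (simp_all add: f')
  also have "\<dots> = (\<integral>\<^sup>+t. f (cis t) * indicator {0..<2 * pi} t \<partial>lborel) / emeasure lborel {0..<2 * pi}"
    by (rule nn_integral_uniform_measure) measurable
  finally show ?thesis by simp
qed

lemma emeasure_circle_space: "emeasure circle_measure (space circle_measure) = 1"
proof -
  have "emeasure circle_measure (space circle_measure) = (\<integral>\<^sup>+z. 1 \<partial>circle_measure)" by simp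
  also have "\<dots> = (\<integral>\<^sup>+t. 1 * indicator {0..<2 * pi} t \<partial>lborel) / ennreal (2 * pi)"
    by (rule nn_integral_circle) simp
  also have "\<dots> = 1" by (simp add: divide_ennreal)
  finally show ?thesis .
qed

lemma finite_measure_circle: "finite_measure circle_measure"
  by (rule finite_measureI) (simp add: emeasure_circle_space)

lemma ident_measurable_circle: "(\<lambda>z. z) \<in> borel_measurable circle_measure"
  by (rule measurable_from_circle) (rule measurable_ident_sets[OF refl])

lemma rotation_measurable:
  assumes "norm c = 1"
  shows "(\<lambda>z. c * z) \<in> measurable circle_measure circle_measure"
proof (rule measurable_into_circle)
  show "(\<lambda>z. c * z) \<in> borel_measurable circle_measure"
    using ident_measurable_circle by (intro borel_measurable_times borel_measurable_const)
qed (use assms in \<open>simp add: space_circle norm_mult\<close>)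

text \<open>In the angular parametrization a rotation is a translation of a \<open>2\<pi>\<close>-periodic function.\<close>

lemma nn_integral_circle_rotate:
  assumes f: "f \<in> borel_measurable circle_measure" and c: "norm c = 1"
  shows "(\<integral>\<^sup>+z. f (c * z) \<partial>circle_measure) = (\<integral>\<^sup>+z. f z \<partial>circle_measure)"
proof -
  obtain \<theta> where \<theta>: "0 \<le> \<theta>" "\<theta> \<le> 2 * pi" "c = cis \<theta>"
  proof
    show "0 \<le> Arg2pi c" "Arg2pi c \<le> 2 * pi" using Arg2pi[of c] by simp_all
    show "c = cis (Arg2pi c)" using Arg2pi_eq[of c] unfolding c cis_conv_exp by simp
  qed
  have g: "(\<lambda>t. f (cis t)) \<in> borel_measurable borel"
    using measurable_compose[OF cis_measurable_circle f] by simp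
  have "(\<integral>\<^sup>+z. f (c * z) \<partial>circle_measure)
      = (\<integral>\<^sup>+t. f (c * cis t) * indicator {0..<2 * pi} t \<partial>lborel) / ennreal (2 * pi)"
    by (rule nn_integral_circle) (rule measurable_compose[OF rotation_measurable[OF c] f])
  also have "\<dots> = (\<integral>\<^sup>+t. f (cis (t + \<theta>)) * indicator {0..<2 * pi} t \<partial>lborel) / ennreal (2 * pi)"
    by (simp add: \<theta>(3) cis_mult add.commute)
  also have "\<dots> = (\<integral>\<^sup>+t. f (cis t) * indicator {0..<2 * pi} t \<partial>lborel) / ennreal (2 * pi)"
    using nn_integral_periodic_shift[OF g _ \<theta>(1,2)] by (simp flip: cis_mult)
  also have "\<dots> = (\<integral>\<^sup>+z. f z \<partial>circle_measure)" by (rule nn_integral_circle[OF f, symmetric])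
  finally show ?thesis .
qed

lemma distr_circle_rotate:
  assumes c: "norm c = 1"
  shows "distr circle_measure circle_measure (\<lambda>z. c * z) = circle_measure"
proof (rule measure_eqI)
  fix A assume "A \<in> sets (distr circle_measure circle_measure (\<lambda>z. c * z))"
  then have A: "A \<in> sets circle_measure" by simp
  note rot = rotation_measurable[OF c]
  have "emeasure (distr circle_measure circle_measure (\<lambda>z. c * z)) A
      = (\<integral>\<^sup>+z. indicator A z \<partial>distr circle_measure circle_measure (\<lambda>z. c * z))"
    using A by simp
  also have "\<dots> = (\<integral>\<^sup>+z. indicator A (c * z) \<partial>circle_measure)"
    using A by (intro nn_integral_distr rot) simp
  also have "\<dots> = emeasure circle_measure A"
    using A by (subst nn_integral_circle_rotate[OF _ c]) auto
  finally show "emeasure (distr circle_measure circle_measure (\<lambda>z. c * z)) A = emeasure circle_measure A" .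
qed simp

lemma powi_measurable_circle: "(\<lambda>z. z powi k) \<in> borel_measurable circle_measure"
proof -
  note [measurable] = ident_measurable_circle
  show ?thesis unfolding power_int_def by (cases "0 \<le> k") simp_all
qed

lemma integrable_powi_circle: "integrable circle_measure (\<lambda>z. z powi k)"
proof (rule finite_measure.integrable_const_bound[OF finite_measure_circle])
  show "AE z in circle_measure. norm (z powi k) \<le> 1"
    by (intro AE_I2) (simp add: space_circle dist_norm norm_power_int)
qed (rule powi_measurable_circle)

text \<open>Rotation by \<open>c\<close> multiplies the integrand by \<open>c\<^sup>k\<close> and leaves the integral unchanged. For \<open>k \<noteq> 0\<close>
the rotation with \<open>c\<^sup>k = -1\<close> forces the integral to vanish, without any antiderivative.\<close>

lemma integral_powi_circle:
  "(LINT z|circle_measure. z powi k) = (if k = 0 then 1 else 0)"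
proof (cases "k = 0")
  case True
  have "measure circle_measure (space circle_measure) = 1"
    by (simp add: measure_def emeasure_circle_space)
  then show ?thesis using True by simp
next
  case False
  define c where "c = cis (pi / of_int k)"
  have c: "norm c = 1" by (simp add: c_def)
  have "c powi k = cis pi" using False by (simp add: c_def cis_power_int)
  then have ck: "c powi k = -1" by (simp add: cis_pi)
  let ?I = "LINT z|circle_measure. z powi k"
  have "?I = (LINT z|distr circle_measure circle_measure (\<lambda>z. c * z). z powi k)"
    by (simp add: distr_circle_rotate[OF c])
  also have "\<dots> = (LINT z|circle_measure. (c * z) powi k)"
    by (rule integral_distr[OF rotation_measurable[OF c] powi_measurable_circle])
  also have "\<dots> = c powi k * ?I" by (simp add: power_int_mult_distrib)
  finally have "?I = - ?I" by (simp add: ck)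
  then show ?thesis using False by simp
qed

lemma product_sigma_finite_circle: "product_sigma_finite (\<lambda>_. circle_measure)"
  by (intro product_sigma_finite.intro finite_measure.axioms(1) finite_measure_circle)

section \<open>The coordinate change preserves the measure of the torus\<close>

text \<open>Shears are the elementary factors of the coordinate change, like elementary matrices for a
unipotent matrix.\<close>

definition shear :: "nat \<Rightarrow> nat \<Rightarrow> (nat \<Rightarrow> complex) \<Rightarrow> nat \<Rightarrow> complex" where
  "shear j k z = z(j := z j * z k)"

lemma space_torus: "z \<in> space (torus n) \<longleftrightarrow> z \<in> extensional {1..n} \<and> (\<forall>j\<in>{1..n}. norm (z j) = 1)"
  by (auto simp: torus_def space_PiM space_circle PiE_def Pi_def dist_norm)

lemma torus_component_measurable:
  assumes "j \<in> {1..n}"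
  shows "(\<lambda>z. z j) \<in> borel_measurable (torus n)"
  unfolding torus_def by (rule measurable_from_circle) (rule measurable_component_singleton[OF assms])

lemma measurable_into_torus:
  assumes "\<And>j. j \<in> {1..n} \<Longrightarrow> (\<lambda>x. f x j) \<in> borel_measurable N"
    and "\<And>x j. x \<in> space N \<Longrightarrow> j \<in> {1..n} \<Longrightarrow> norm (f x j) = 1"
    and "\<And>x. x \<in> space N \<Longrightarrow> f x \<in> extensional {1..n}"
  shows "f \<in> measurable N (torus n)"
  unfolding torus_def
proof (rule measurable_PiM_single')
  show "(\<lambda>x. f x j) \<in> measurable N circle_measure" if "j \<in> {1..n}" for j
    using that by (intro measurable_into_circle assms(1,2))
  show "f \<in> space N \<rightarrow> (\<Pi>\<^sub>E j\<in>{1..n}. space circle_measure)"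
    using assms(2,3) by (auto simp: space_circle dist_norm PiE_def)
qed

lemma shear_measurable:
  assumes "j \<in> {1..n}" "k \<in> {1..n}"
  shows "shear j k \<in> measurable (torus n) (torus n)"
proof (rule measurable_into_torus)
  fix i assume i: "i \<in> {1..n}"
  note [measurable] = torus_component_measurable[OF i] torus_component_measurable[OF assms(1)]
    torus_component_measurable[OF assms(2)]
  show "(\<lambda>z. shear j k z i) \<in> borel_measurable (torus n)"
    unfolding shear_def by (cases "i = j") simp_all
qed (use assms in \<open>auto simp: shear_def space_torus norm_mult extensional_def\<close>)

text \<open>With all coordinates except the \<open>j\<close>-th frozen, a shear is a rotation of the \<open>j\<close>-th circle by the
fixed unimodular number \<open>z\<^sub>k\<close>; Fubini's theorem does the rest.\<close>

lemma shear_preserving: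
  assumes jk: "j \<in> {1..n}" "k \<in> {1..n}" "j \<noteq> k"
  shows "distr (torus n) (torus n) (shear j k) = torus n"
proof (rule measure_eqI)
  interpret product_sigma_finite "\<lambda>_. circle_measure" by (rule product_sigma_finite_circle)
  define I where "I = {1..n} - {j}"
  have I: "finite I" "j \<notin> I" "insert j I = {1..n}" "k \<in> I" using jk by (auto simp: I_def)
  have torus: "torus n = PiM (insert j I) (\<lambda>_. circle_measure)" by (simp add: torus_def I(3))
  have fubini: "(\<integral>\<^sup>+z. f z \<partial>torus n)
      = (\<integral>\<^sup>+x. (\<integral>\<^sup>+y. f (x(j := y)) \<partial>circle_measure) \<partial>PiM I (\<lambda>_. circle_measure))"
    if "f \<in> borel_measurable (torus n)" for f :: "(nat \<Rightarrow> complex) \<Rightarrow> ennreal"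
    using product_nn_integral_insert[OF I(1,2), of f] that by (simp add: torus)
  fix A assume "A \<in> sets (distr (torus n) (torus n) (shear j k))"
  then have A: "A \<in> sets (torus n)" by simp
  note shear = shear_measurable[OF jk(1,2)]
  have "emeasure (distr (torus n) (torus n) (shear j k)) A
      = (\<integral>\<^sup>+z. indicator A z \<partial>distr (torus n) (torus n) (shear j k))"
    using A by simp
  also have "\<dots> = (\<integral>\<^sup>+z. indicator A (shear j k z) \<partial>torus n)"
    using A by (intro nn_integral_distr shear) simp
  also have "\<dots> = (\<integral>\<^sup>+x. (\<integral>\<^sup>+y. indicator A (shear j k (x(j := y))) \<partial>circle_measure) \<partial>PiM I (\<lambda>_. circle_measure))"
    by (rule fubini, rule measurable_compose[OF shear]) (use A in simp)
  also have "\<dots> = (\<integral>\<^sup>+x. (\<integral>\<^sup>+y. indicator A (x(j := y)) \<partial>circle_measure) \<partial>PiM I (\<lambda>_. circle_measure))"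
  proof (rule nn_integral_cong)
    fix x assume x: "x \<in> space (PiM I (\<lambda>_. circle_measure))"
    then have xk: "norm (x k) = 1" using I(4) by (auto simp: space_PiM space_circle dist_norm)
    have "(\<lambda>y. x(j := y)) \<in> measurable circle_measure (torus n)"
      unfolding torus by (rule measurable_component_update[OF x I(2)])
    then have "(\<lambda>y. indicator A (x(j := y)) :: ennreal) \<in> borel_measurable circle_measure"
      by (rule measurable_compose) (use A in simp)
    from nn_integral_circle_rotate[OF this xk]
    show "(\<integral>\<^sup>+y. indicator A (shear j k (x(j := y))) \<partial>circle_measure)
        = (\<integral>\<^sup>+y. indicator A (x(j := y)) \<partial>circle_measure)"
      using jk(3) by (simp add: shear_def mult.commute)
  qed
  also have "\<dots> = (\<integral>\<^sup>+z. indicator A z \<partial>torus n)"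
    by (rule fubini[symmetric]) (use A in simp)
  also have "\<dots> = emeasure (torus n) A" using A by simp
  finally show "emeasure (distr (torus n) (torus n) (shear j k)) A = emeasure (torus n) A" .
qed simp

lemma torus_norm: "z \<in> space (torus n) \<Longrightarrow> j \<in> {1..n} \<Longrightarrow> norm (z j) = 1"
  by (simp add: space_torus)

lemma torus_nonzero:
  assumes "z \<in> space (torus n)" "j \<in> {1..n}"
  shows "z j \<noteq> 0"
  using torus_norm[OF assms] by auto

lemma finite_measure_torus: "finite_measure (torus n)"
proof (rule finite_measureI)
  interpret product_sigma_finite "\<lambda>_. circle_measure" by (rule product_sigma_finite_circle)
  have "emeasure (torus n) (PiE {1..n} (\<lambda>_. space circle_measure))
      = (\<Prod>j\<in>{1..n}. emeasure circle_measure (space circle_measure))"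
    unfolding torus_def by (rule emeasure_PiM) auto
  then show "emeasure (torus n) (space (torus n)) \<noteq> \<infinity>"
    by (simp add: emeasure_circle_space torus_def space_PiM)
qed

text \<open>These maps interpolate between the identity of the torus (at \<open>m = n\<close>) and \<open>hartogs_map_inv n\<close> (at
\<open>m = 1\<close>); two consecutive ones differ by a shear.\<close>

definition partial_products :: "nat \<Rightarrow> nat \<Rightarrow> (nat \<Rightarrow> complex) \<Rightarrow> nat \<Rightarrow> complex" where
  "partial_products n m z = (\<lambda>j\<in>{1..n}. if m \<le> j then \<Prod>i=j..n. z i else z j)"

lemma partial_products_preserving:
  assumes "1 \<le> m" "m \<le> n"
  shows "partial_products n m \<in> measurable (torus n) (torus n) \<and>
    distr (torus n) (torus n) (partial_products n m) = torus n"
  using assms(2,1)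
proof (induction m rule: inc_induct)
  case base
  have eq: "partial_products n n z = z" if "z \<in> space (torus n)" for z
    using that base by (auto simp: partial_products_def space_torus extensional_def fun_eq_iff)
  have "partial_products n n \<in> measurable (torus n) (torus n)"
    by (subst measurable_cong[OF eq]) (auto intro: measurable_ident_sets)
  moreover have "distr (torus n) (torus n) (partial_products n n) = distr (torus n) (torus n) (\<lambda>z. z)"
    by (rule distr_cong) (auto simp: eq)
  ultimately show ?case by simp
next
  case (step m)
  have step': "partial_products n m = shear m (Suc m) \<circ> partial_products n (Suc m)"
  proof (intro ext)
    fix z :: "nat \<Rightarrow> complex" and j
    have "(\<Prod>i=m..n. z i) = z m * (\<Prod>i=Suc m..n. z i)"
      using step.hyps by (simp add: prod.atLeast_Suc_atMost)
    then show "partial_products n m z j = (shear m (Suc m) \<circ> partial_products n (Suc m)) z j"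
      using step.hyps step.prems by (auto simp: partial_products_def shear_def)
  qed
  have IH: "partial_products n (Suc m) \<in> measurable (torus n) (torus n)"
    "distr (torus n) (torus n) (partial_products n (Suc m)) = torus n"
    using step by auto
  have m: "m \<in> {1..n}" "Suc m \<in> {1..n}" using step by auto
  have "partial_products n m \<in> measurable (torus n) (torus n)"
    unfolding step' by (rule measurable_comp[OF IH(1) shear_measurable[OF m]])
  moreover have "distr (torus n) (torus n) (partial_products n m) = torus n"
    unfolding step' distr_distr[OF shear_measurable[OF m] IH(1), symmetric] IH(2)
    by (rule shear_preserving[OF m]) simp
  ultimately show ?case by blast
qed

lemma hartogs_map_inv_preserving:
  assumes "1 \<le> n"
  shows "hartogs_map_inv n \<in> measurable (torus n) (torus n)"
    and "distr (torus n) (torus n) (hartogs_map_inv n) = torus n"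
proof -
  have "hartogs_map_inv n = partial_products n 1"
    by (auto simp: hartogs_map_inv_def partial_products_def fun_eq_iff)
  then show "hartogs_map_inv n \<in> measurable (torus n) (torus n)"
    "distr (torus n) (torus n) (hartogs_map_inv n) = torus n"
    using partial_products_preserving[of 1 n] assms by simp_all
qed

lemma hartogs_map_measurable:
  assumes "1 \<le> n"
  shows "hartogs_map n \<in> measurable (torus n) (torus n)"
proof (rule measurable_into_torus)
  fix j assume j: "j \<in> {1..n}"
  show "(\<lambda>z. hartogs_map n z j) \<in> borel_measurable (torus n)"
  proof (cases "j = n")
    case True
    then show ?thesis using j torus_component_measurable[OF j] by (simp add: hartogs_map_def)
  next
    case False
    then have "j + 1 \<in> {1..n}" using j by auto
    note [measurable] = torus_component_measurable[OF j] torus_component_measurable[OF this]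
    have "(\<lambda>z. z j / z (j + 1)) \<in> borel_measurable (torus n)" by measurable
    then show ?thesis using False j by (simp add: hartogs_map_def)
  qed
next
  fix z j assume "z \<in> space (torus n)" "j \<in> {1..n}"
  then show "norm (hartogs_map n z j) = 1"
    by (auto simp: hartogs_map_def norm_divide torus_norm)
qed (simp add: hartogs_map_def)

lemma hartogs_map_left_inverse:
  assumes "z \<in> space (torus n)"
  shows "hartogs_map n (hartogs_map_inv n z) = z"
proof
  fix j
  show "hartogs_map n (hartogs_map_inv n z) j = z j"
  proof (cases "j \<in> {1..n}")
    case j: True
    show ?thesis
    proof (cases "j = n")
      case True
      then show ?thesis using j by (simp add: hartogs_map_def hartogs_map_inv_def)
    next
      case False
      have "(\<Prod>i=j..n. z i) = z j * (\<Prod>i=j+1..n. z i)"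
        using j by (simp add: prod.atLeast_Suc_atMost)
      moreover have "(\<Prod>i=j+1..n. z i) \<noteq> 0"
        using torus_nonzero[OF assms] j by auto
      ultimately show ?thesis using j False by (simp add: hartogs_map_def hartogs_map_inv_def)
    qed
  next
    case False
    then have "z j = undefined" using assms by (simp add: space_torus extensional_def)
    then show ?thesis using False by (auto simp: hartogs_map_def)
  qed
qed

text \<open>The product of the quotients \<open>z\<^sub>i / z\<^bsub>i+1\<^esub>\<close> telescopes, closed off by the last factor \<open>z\<^sub>n\<close>.\<close>

lemma hartogs_map_right_inverse:
  assumes "z \<in> space (torus n)"
  shows "hartogs_map_inv n (hartogs_map n z) = z"
proof
  fix j
  have telescope: "(\<Prod>i=j..n. hartogs_map n z i) = z j" if "j \<le> n" "1 \<le> j"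
    using that
  proof (induction j rule: inc_induct)
    case base
    then show ?case by (simp add: hartogs_map_def)
  next
    case (step j)
    have "(\<Prod>i=j..n. hartogs_map n z i) = hartogs_map n z j * z (Suc j)"
      using step by (simp add: prod.atLeast_Suc_atMost)
    also have "\<dots> = z j"
      using step torus_nonzero[OF assms, of "Suc j"] by (simp add: hartogs_map_def)
    finally show ?case .
  qed
  show "hartogs_map_inv n (hartogs_map n z) j = z j"
  proof (cases "j \<in> {1..n}")
    case True
    then show ?thesis using telescope by (simp add: hartogs_map_inv_def)
  next
    case False
    then have "z j = undefined" using assms by (simp add: space_torus extensional_def)
    then show ?thesis using False by (auto simp: hartogs_map_inv_def)
  qed
qed

section \<open>Laurent monomials\<close>

lemma norm_laurent_monom:
  assumes "z \<in> space (torus n)"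
  shows "norm (laurent_monom n \<alpha> z) = 1"
  unfolding laurent_monom_def prod_norm[symmetric]
  by (intro prod.neutral ballI) (simp add: norm_power_int torus_norm[OF assms])

lemma laurent_monom_measurable: "laurent_monom n \<alpha> \<in> borel_measurable (torus n)"
  unfolding laurent_monom_def[abs_def]
proof (rule borel_measurable_prod)
  fix j assume j: "j \<in> {1..n}"
  show "(\<lambda>z. z j powi \<alpha> j) \<in> borel_measurable (torus n)"
    unfolding torus_def
    by (rule measurable_compose[OF measurable_component_singleton[OF j] powi_measurable_circle])
qed

lemma laurent_monom_in_L2: "laurent_monom n \<alpha> \<in> L2_fun (torus n)"
  by (rule finite_measure.bounded_in_L2_fun[OF finite_measure_torus, where C = 1])
     (simp_all add: laurent_monom_measurable norm_laurent_monom)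

lemma integral_laurent_monom:
  "(LINT z|torus n. laurent_monom n \<alpha> z) = (if \<forall>j\<in>{1..n}. \<alpha> j = 0 then 1 else 0)"
proof -
  have "(LINT z|torus n. laurent_monom n \<alpha> z) = (\<Prod>j\<in>{1..n}. LINT z|circle_measure. z powi \<alpha> j)"
    unfolding torus_def laurent_monom_def
    by (rule product_sigma_finite.product_integral_prod[OF product_sigma_finite_circle])
       (simp_all add: integrable_powi_circle)
  also have "\<dots> = (if \<forall>j\<in>{1..n}. \<alpha> j = 0 then 1 else 0)"
    by (auto simp: integral_powi_circle)
  finally show ?thesis .
qed

text \<open>On the torus conjugation inverts each coordinate, so the inner product of two monomials is the
integral of the monomial with the difference of the exponents. Exponents are extensional
functions, hence distinct ones differ at some coordinate in \<open>{1..n}\<close>.\<close>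

lemma laurent_monom_orthonormal:
  assumes "A \<subseteq> {1..n} \<rightarrow>\<^sub>E UNIV"
  shows "orthonormal_family (torus n) (laurent_monom n) A"
proof (intro orthonormal_family.intro orthonormal_family_axioms.intro finite_measure_torus laurent_monom_in_L2)
  fix \<alpha> \<beta> assume "\<alpha> \<in> A" "\<beta> \<in> A"
  then have ext: "\<alpha> \<in> {1..n} \<rightarrow>\<^sub>E UNIV" "\<beta> \<in> {1..n} \<rightarrow>\<^sub>E UNIV" using assms by auto
  have "inner_fun (torus n) (laurent_monom n \<alpha>) (laurent_monom n \<beta>)
      = (LINT z|torus n. laurent_monom n (\<lambda>j. \<alpha> j - \<beta> j) z)"
    unfolding inner_fun_def
  proof (rule Bochner_Integration.integral_cong)
    fix z assume z: "z \<in> space (torus n)"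
    have "z j powi \<alpha> j * cnj (z j powi \<beta> j) = z j powi (\<alpha> j - \<beta> j)" if j: "j \<in> {1..n}" for j
    proof -
      have "z j * cnj (z j) = 1"
        using torus_norm[OF z j] by (simp flip: complex_norm_square)
      then have "cnj (z j) = inverse (z j)" by (rule inverse_unique[symmetric])
      then show ?thesis
        using torus_nonzero[OF z j]
        by (simp add: power_int_diff power_int_inverse divide_inverse)
    qed
    then show "laurent_monom n \<alpha> z * cnj (laurent_monom n \<beta> z) = laurent_monom n (\<lambda>j. \<alpha> j - \<beta> j) z"
      unfolding laurent_monom_def cnj_prod prod.distrib[symmetric] by (intro prod.cong) auto
  qed simp
  also have "\<dots> = (if \<forall>j\<in>{1..n}. \<alpha> j = \<beta> j then 1 else 0)"
    by (simp add: integral_laurent_monom)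
  also have "(\<forall>j\<in>{1..n}. \<alpha> j = \<beta> j) \<longleftrightarrow> \<alpha> = \<beta>"
    using PiE_ext[OF ext] by auto
  finally show "inner_fun (torus n) (laurent_monom n \<alpha>) (laurent_monom n \<beta>) = (if \<alpha> = \<beta> then 1 else 0)" .
qed

section \<open>The action on exponents\<close>

text \<open>The effect of the operator on exponents: the partial sums come from the substitution, and
\<open>i - 1\<close> is the exponent of \<open>z\<^sub>i\<close> in the Jacobian.\<close>

definition index_shift :: "nat \<Rightarrow> (nat \<Rightarrow> int) \<Rightarrow> nat \<Rightarrow> int" where
  "index_shift n \<alpha> = (\<lambda>i\<in>{1..n}. (\<Sum>j=1..i. \<alpha> j) + int i - 1)"

lemma inj_on_index_shift: "inj_on (index_shift n) (hartogs_indices n)"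
proof (rule inj_onI)
  fix \<alpha> \<beta> assume \<alpha>: "\<alpha> \<in> hartogs_indices n" and \<beta>: "\<beta> \<in> hartogs_indices n"
    and eq: "index_shift n \<alpha> = index_shift n \<beta>"
  have sums: "(\<Sum>j=1..i. \<alpha> j) = (\<Sum>j=1..i. \<beta> j)" if "i \<le> n" for i
  proof (cases "i = 0")
    case False
    then show ?thesis using fun_cong[OF eq, of i] that by (simp add: index_shift_def)
  qed simp
  show "\<alpha> = \<beta>"
  proof (rule PiE_ext)
    show "\<alpha> \<in> {1..n} \<rightarrow>\<^sub>E UNIV" "\<beta> \<in> {1..n} \<rightarrow>\<^sub>E UNIV"
      using \<alpha> \<beta> by (simp_all add: hartogs_indices_def)
    fix i assume i: "i \<in> {1..n}"
    then obtain k where k: "i = Suc k" by (cases i) auto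
    show "\<alpha> i = \<beta> i" using sums[of k] sums[of "Suc k"] i by (simp add: k)
  qed
qed

text \<open>The defining inequalities of \<open>hartogs_indices\<close> are the nonnegativity of the shifted exponents. The
preimage of \<open>\<beta>\<close> is found by taking successive differences, with the \<open>i - 1\<close> removed.\<close>

lemma index_shift_image: "index_shift n ` hartogs_indices n = polydisc_indices n"
proof (intro equalityI subsetI)
  fix \<beta> assume \<beta>: "\<beta> \<in> polydisc_indices n"
  define \<alpha> where "\<alpha> = (\<lambda>i\<in>{1..n}. if i = 1 then \<beta> 1 else \<beta> i - \<beta> (i - 1) - 1)"
  have sum: "(\<Sum>j=1..Suc i. \<alpha> j) = \<beta> (Suc i) - int i" if "Suc i \<le> n" for i
    using that
  proof (induction i)
    case 0
    then show ?case by (simp add: \<alpha>_def)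
  next
    case (Suc i)
    then have "(\<Sum>j=1..Suc i. \<alpha> j) = \<beta> (Suc i) - int i" by simp
    moreover have "\<alpha> (Suc (Suc i)) = \<beta> (Suc (Suc i)) - \<beta> (Suc i) - 1"
      using Suc.prems by (simp add: \<alpha>_def)
    ultimately show ?case by simp
  qed
  have sum': "(\<Sum>j=1..i. \<alpha> j) + int i - 1 = \<beta> i" if "i \<in> {1..n}" for i
    using that sum[of "i - 1"] by (cases i) auto
  have "\<alpha> \<in> {1..n} \<rightarrow>\<^sub>E UNIV" by (simp add: \<alpha>_def)
  moreover have "0 \<le> (\<Sum>j=1..i. \<alpha> j) + int i - 1" if "i \<in> {1..n}" for i
    using \<beta> sum'[OF that] that by (auto simp: polydisc_indices_def)
  ultimately have "\<alpha> \<in> hartogs_indices n" by (simp add: hartogs_indices_def)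
  moreover have "index_shift n \<alpha> = \<beta>"
  proof
    fix i
    show "index_shift n \<alpha> i = \<beta> i"
    proof (cases "i \<in> {1..n}")
      case True
      then show ?thesis using sum'[OF True] by (simp add: index_shift_def)
    next
      case False
      have "\<beta> i = undefined"
        using \<beta> False unfolding polydisc_indices_def by (rule PiE_arb)
      then show ?thesis
        using False unfolding index_shift_def by (simp only: restrict_apply if_False)
    qed
  qed
  ultimately show "\<beta> \<in> index_shift n ` hartogs_indices n" by blast
qed (auto simp: hartogs_indices_def polydisc_indices_def index_shift_def)

lemma prod_powi:
  fixes f :: "'b \<Rightarrow> complex"
  shows "(\<Prod>i\<in>I. f i) powi k = (\<Prod>i\<in>I. f i powi k)"
  by (induction I rule: infinite_finite_induct) (simp_all add: power_int_mult_distrib)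

lemma powi_sum:
  fixes z :: complex
  assumes "z \<noteq> 0"
  shows "(\<Prod>j\<in>J. z powi f j) = z powi (\<Sum>j\<in>J. f j)"
  using assms by (induction J rule: infinite_finite_induct) (simp_all add: power_int_add)

text \<open>With integer exponents the Jacobian is itself a Laurent monomial, whose exponents add to those of
the monomial it multiplies; the factor for \<open>i = 1\<close> is trivial.\<close>

lemma jacobian_hartogs_map_inv_powi:
  "jacobian n (hartogs_map_inv n) z = (\<Prod>i=1..n. z i powi (int i - 1))"
proof -
  have "(\<Prod>i=1..n. z i powi (int i - 1)) = (\<Prod>i=1..n. z i ^ (i - 1))"
  proof (rule prod.cong)
    fix i assume "i \<in> {1..n}"
    then have "int i - 1 = int (i - 1)" by auto
    then show "z i powi (int i - 1) = z i ^ (i - 1)" by (simp only: power_int_of_nat)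
  qed simp
  also have "\<dots> = (\<Prod>i=2..n. z i ^ (i - 1))"
    by (rule prod.mono_neutral_right) (auto simp: not_le le_Suc_eq numeral_2_eq_2)
  finally show ?thesis by (simp add: jacobian_hartogs_map_inv)
qed

text \<open>Substituting \<open>\<Prod>\<^bsub>i \<ge> j\<^esub> z\<^sub>i\<close> for the \<open>j\<close>-th coordinate and exchanging the two products collects, for
each \<open>z\<^sub>i\<close>, the exponents \<open>\<alpha>\<^sub>j\<close> with \<open>j \<le> i\<close>.\<close>

lemma laurent_monom_hartogs_map_inv:
  assumes z: "z \<in> space (torus n)"
  shows "jacobian n (hartogs_map_inv n) z * laurent_monom n \<alpha> (hartogs_map_inv n z)
    = laurent_monom n (index_shift n \<alpha>) z"
proof -
  have "laurent_monom n \<alpha> (hartogs_map_inv n z) = (\<Prod>j\<in>{1..n}. \<Prod>i\<in>{i \<in> {1..n}. j \<le> i}. z i powi \<alpha> j)"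
    unfolding laurent_monom_def
  proof (rule prod.cong)
    fix j assume j: "j \<in> {1..n}"
    then have "{i \<in> {1..n}. j \<le> i} = {j..n}" by auto
    then show "hartogs_map_inv n z j powi \<alpha> j = (\<Prod>i\<in>{i \<in> {1..n}. j \<le> i}. z i powi \<alpha> j)"
      using j by (simp add: hartogs_map_inv_def prod_powi)
  qed simp
  also have "\<dots> = (\<Prod>i\<in>{1..n}. \<Prod>j\<in>{j \<in> {1..n}. j \<le> i}. z i powi \<alpha> j)"
    by (rule prod.swap_restrict) auto
  also have "\<dots> = (\<Prod>i\<in>{1..n}. z i powi (\<Sum>j=1..i. \<alpha> j))"
  proof (rule prod.cong)
    fix i assume i: "i \<in> {1..n}"
    then have "{j \<in> {1..n}. j \<le> i} = {1..i}" by auto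
    then show "(\<Prod>j\<in>{j \<in> {1..n}. j \<le> i}. z i powi \<alpha> j) = z i powi (\<Sum>j=1..i. \<alpha> j)"
      using powi_sum[OF torus_nonzero[OF z i]] by simp
  qed simp
  finally have "jacobian n (hartogs_map_inv n) z * laurent_monom n \<alpha> (hartogs_map_inv n z)
      = (\<Prod>i=1..n. z i powi (int i - 1) * z i powi (\<Sum>j=1..i. \<alpha> j))"
    by (simp only: jacobian_hartogs_map_inv_powi prod.distrib)
  also have "\<dots> = laurent_monom n (index_shift n \<alpha>) z"
    unfolding laurent_monom_def
  proof (rule prod.cong)
    fix i assume i: "i \<in> {1..n}"
    have "z i powi (int i - 1) * z i powi (\<Sum>j=1..i. \<alpha> j) = z i powi (int i - 1 + (\<Sum>j=1..i. \<alpha> j))"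
      using torus_nonzero[OF z i] by (simp only: power_int_add disj_not1 simp_thms)
    then show "z i powi (int i - 1) * z i powi (\<Sum>j=1..i. \<alpha> j) = z i powi index_shift n \<alpha> i"
      using i by (simp add: index_shift_def algebra_simps)
  qed simp
  finally show ?thesis .
qed

section \<open>The Toeplitz operators\<close>

lemma jacobian_weight:
  "(\<lambda>z. jacobian n (hartogs_map_inv n) z) = laurent_monom n (\<lambda>i. int i - 1)"
  by (simp add: fun_eq_iff jacobian_hartogs_map_inv_powi laurent_monom_def)

lemma hartogs_weighted_composition:
  assumes "1 \<le> n"
  shows "weighted_composition (torus n) (hartogs_map_inv n) (hartogs_map n)
    (jacobian n (hartogs_map_inv n))"
proof
  show "jacobian n (hartogs_map_inv n) \<in> borel_measurable (torus n)"
    unfolding jacobian_weight by (rule laurent_monom_measurable)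
  show "norm (jacobian n (hartogs_map_inv n) z) = 1" if "z \<in> space (torus n)" for z
    using norm_laurent_monom[OF that] by (simp add: jacobian_weight)
qed (use assms in \<open>simp_all add: hartogs_map_inv_preserving hartogs_map_measurable
       hartogs_map_left_inverse hartogs_map_right_inverse\<close>)

lemma hardy_eq_closed_span: "hardy n A = closed_span (torus n) (laurent_monom n) A"
  by (simp add: hardy_def closed_span_def)

theorem theorem4p1:
  fixes n :: nat
  assumes "n \<ge> 2"
  shows "unitary_between (torus n) (H2_hartogs n) (H2_polydisc n) (Psi n) \<and>
    (\<forall>\<phi> \<in> Linfty_fun (torus n).
       (\<forall>F \<in> H2_hartogs n.
          toeplitz_hartogs n \<phi> F =
            Psi_inv n (toeplitz_polydisc n (\<phi> \<circ> hartogs_map_inv n) (Psi n F))) \<and>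
       (\<forall>F \<in> H2_polydisc n.
          toeplitz_polydisc n \<phi> F =
            Psi n (toeplitz_hartogs n (\<phi> \<circ> hartogs_map n) (Psi_inv n F))))"
proof -
  have n1: "1 \<le> n" using assms by simp
  interpret weighted_composition "torus n" "hartogs_map_inv n" "hartogs_map n"
    "jacobian n (hartogs_map_inv n)"
    by (rule hartogs_weighted_composition[OF n1])
  have Psi: "Psi n = class_wcomp" by (simp add: fun_eq_iff Psi_def class_wcomp_def)
  let ?H = "H2_hartogs n"
  have H: "?H \<subseteq> L2 (torus n)"
    unfolding H2_hartogs_def hardy_eq_closed_span by (rule closed_span_subset_L2)
  have image: "class_wcomp ` ?H = H2_polydisc n"
    unfolding H2_hartogs_def H2_polydisc_def hardy_eq_closed_span index_shift_image[symmetric]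
    by (rule class_wcomp_closed_span[OF inj_on_index_shift])
       (simp_all add: laurent_monom_in_L2 wcomp_def laurent_monom_hartogs_map_inv)
  have unitary: "unitary_between (torus n) ?H (H2_polydisc n) (Psi n)"
    using unitary_class_wcomp[OF H] by (simp add: Psi image)
  then have bij: "bij_betw (Psi n) ?H (H2_polydisc n)" by (simp add: unitary_between_def)
  have proj_H: "unique_projection (torus n) ?H G" if "G \<in> L2 (torus n)" for G
    unfolding H2_hartogs_def hardy_eq_closed_span
    by (rule orthonormal_family.unique_projection_closed_span[OF laurent_monom_orthonormal that])
       (simp add: hartogs_indices_def)
  have proj_WH: "unique_projection (torus n) (class_wcomp ` ?H) G" if "G \<in> L2 (torus n)" for G
    unfolding image H2_polydisc_def hardy_eq_closed_span
    by (rule orthonormal_family.unique_projection_closed_span[OF laurent_monom_orthonormal that])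
       (auto simp: polydisc_indices_def)
  have intertwine: "toeplitz_polydisc n (\<phi> \<circ> hartogs_map_inv n) (Psi n F)
      = Psi n (toeplitz_hartogs n \<phi> F)"
    if "\<phi> \<in> Linfty_fun (torus n)" "F \<in> ?H" for \<phi> F
    using toeplitz_class_wcomp[OF H that(1) subsetD[OF H that(2)] proj_H proj_WH]
    by (simp add: toeplitz_polydisc_def toeplitz_hartogs_def Psi image)
  have toeplitz_in: "toeplitz_hartogs n \<phi> F \<in> ?H"
    if "\<phi> \<in> Linfty_fun (torus n)" "F \<in> ?H" for \<phi> F
    unfolding toeplitz_hartogs_def toeplitz_def
    by (intro orth_proj_in(1) proj_H L2_class_in_L2 bounded_mult_in_L2 L2_rep_in_L2_fun
        that(1) subsetD[OF H that(2)])
  show ?thesis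
  proof (intro conjI unitary ballI)
    fix \<phi> F assume \<phi>: "\<phi> \<in> Linfty_fun (torus n)" and F: "F \<in> ?H"
    show "toeplitz_hartogs n \<phi> F =
        Psi_inv n (toeplitz_polydisc n (\<phi> \<circ> hartogs_map_inv n) (Psi n F))"
      unfolding intertwine[OF \<phi> F]
      using inv_into_f_f[OF bij_betw_imp_inj_on[OF bij] toeplitz_in[OF \<phi> F]] by simp
  next
    fix \<phi> F assume \<phi>: "\<phi> \<in> Linfty_fun (torus n)" and F: "F \<in> H2_polydisc n"
    interpret inv: weighted_composition "torus n" "hartogs_map n" "hartogs_map_inv n"
      "\<lambda>z. cnj (jacobian n (hartogs_map_inv n) (hartogs_map n z))"
      by (rule inverse)
    have \<phi>': "\<phi> \<circ> hartogs_map n \<in> Linfty_fun (torus n)" by (rule inv.Linfty_T[OF \<phi>])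
    have F_image: "F \<in> Psi n ` ?H" using F bij_betw_imp_surj_on[OF bij] by simp
    note F' = inv_into_into[OF F_image] f_inv_into_f[OF F_image]
    have FL2: "F \<in> L2 (torus n)" 
      using class_wcomp_in_L2[OF subsetD[OF H F'(1)]] F'(2) by (simp only: Psi)
    \<comment> \<open>The composed symbol agrees with \<open>\<phi>\<close> only on the torus, hence the detour through classes.\<close>
    let ?\<psi> = "(\<phi> \<circ> hartogs_map n) \<circ> hartogs_map_inv n"
    have "Psi n (toeplitz_hartogs n (\<phi> \<circ> hartogs_map n) (Psi_inv n F)) = toeplitz_polydisc n ?\<psi> F"
      using intertwine[OF \<phi>' F'(1)] by (simp add: F'(2))
    also have "L2_class (torus n) (\<lambda>z. ?\<psi> z * L2_rep F z) = L2_class (torus n) (\<lambda>z. \<phi> z * L2_rep F z)"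
      by (intro L2_class_eqI bounded_mult_in_L2 Linfty_T \<phi> \<phi>' L2_rep_in_L2_fun FL2 AE_I2)
         (simp add: hartogs_map_left_inverse)
    then have "toeplitz_polydisc n ?\<psi> F = toeplitz_polydisc n \<phi> F"
      by (simp add: toeplitz_polydisc_def toeplitz_def)
    finally show "toeplitz_polydisc n \<phi> F =
        Psi n (toeplitz_hartogs n (\<phi> \<circ> hartogs_map n) (Psi_inv n F))" by simp
  qed
qed

end
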